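(* Let $(M,F)$ be a Berwald space. Then the holonomy group $Hol(\nabla)$ of its Chern-Rund connection $\nabla$ is Riemannian, i.e. it is the holonomy group of the Levi-Civita connection of a Riemannian metric on $M$.
   Context: The summation convention is used. $M$ is an $n$-dimensional smooth manifold, $N=TM\setminus\{0\}$ is the slit tangent bundle, and local coordinates $(x^i)$ on $M$ induce natural coordinates $(x^i,y^i)$ on $TM$. A Finsler space $(M,F)$ is a manifold $M$ with a function $F:TM\to[0,\infty)$ that is smooth on $N$, satisfies $F(x,\lambda y)=\lambda F(x,y)$ for $\lambda\ge 0$, and for which $g_{ij}(x,y):=\frac12\frac{\partial^2F^2}{\partial y^i\partial y^j}$ is positive definite on $N$. Put $A_{ijk}=\frac F2\frac{\partial g_{ij}}{\partial y^k}$, $A^i_{jk}=g^{il}A_{ljk}$, $\gamma^i_{jk}=\frac12g^{is}\big(\frac{\partial g_{sj}}{\partial x^k}-\frac{\partial g_{jk}}{\partial x^s}+\frac{\partial g_{sk}}{\partial x^j}\big)$, define $N^i_j$ by $\frac{N^i_j}{F}=\gamma^i_{jk}\frac{y^k}{F}-A^i_{jk}\gamma^k_{rs}\frac{y^r}{F}\frac{y^s}{F}$, and put $\delta y^i=dy^i+N^i_jdx^j$. The Chern-Rund connection is the unique linear connection on the pull-back bundle $\hat\pi^*TM\to N$ (where $\hat\pi:N\to M$) whose connection 1-forms $\omega^i_j$ satisfy $d(dx^i)-dx^j\wedge\omega^i_j=0$ and $dg_{ij}-g_{kj}\omega^k_i-g_{ik}\omega^k_j=2A_{ijk}\frac{\delta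 y^k}{F}$; then $\omega^i_j=\Gamma^i_{jk}(x,y)\,dx^k$ with $\Gamma^i_{jk}=\Gamma^i_{kj}$. A Berwald space is a Finsler space whose Chern-Rund connection also defines an affine connection on $M$, i.e. the coefficients $\Gamma^i_{jk}$ depend on $x$ only. $Hol(\nabla)$ is the holonomy group of this affine connection on $M$, with respect to any base point. *)

theory Defs
  imports "HOL-Analysis.Analysis" "HOL-Algebra.Bij"
begin

section \<open>Smooth manifolds and tangent vectors\<close>

primrec Ck_on :: "nat \<Rightarrow> 'e::real_normed_vector set \<Rightarrow> ('e \<Rightarrow> 'f::real_normed_vector) \<Rightarrow> bool" where
  "Ck_on 0 S f \<longleftrightarrow> continuous_on S f"
| "Ck_on (Suc k) S f \<longleftrightarrow> (\<forall>x\<in>S. f differentiable (at x)) \<and>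
     (\<forall>v. Ck_on k S (\<lambda>x. frechet_derivative f (at x) v))"

text \<open>Only used for open sets of finite-dimensional spaces.\<close>

definition smooth_on :: "'e::real_normed_vector set \<Rightarrow> ('e \<Rightarrow> 'f::real_normed_vector) \<Rightarrow> bool" where
  "smooth_on S f \<longleftrightarrow> (\<forall>k. Ck_on k S f)"

text \<open>A chart is a pair of a domain and a coordinate map; the values of the coordinate map outside
  the domain are irrelevant.\<close>

type_synonym ('a, 'n) chart = "'a set \<times> ('a \<Rightarrow> real^'n)"

abbreviation chart_dom :: "('a, 'n::finite) chart \<Rightarrow> 'a set" where
  "chart_dom c \<equiv> fst c"

definition chart_img :: "('a, 'n::finite) chart \<Rightarrow> (real^'n) set" where
  "chart_img c = snd c ` chart_dom c"

definition chart_inv :: "('a, 'n::finite) chart \<Rightarrow> real^'n \<Rightarrow> 'a" where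
  "chart_inv c = inv_into (chart_dom c) (snd c)"

definition transition :: "('a, 'n::finite) chart \<Rightarrow> ('a, 'n) chart \<Rightarrow> real^'n \<Rightarrow> real^'n" where
  "transition c d = snd d \<circ> chart_inv c"

definition overlap :: "('a, 'n::finite) chart \<Rightarrow> ('a, 'n) chart \<Rightarrow> (real^'n) set" where
  "overlap c d = snd c ` (chart_dom c \<inter> chart_dom d)"

text \<open>The smooth structure is given by any smooth atlas, not necessarily a maximal one.
  The dimension is \<open>CARD('n)\<close>.\<close>

definition smooth_manifold :: "'a topology \<Rightarrow> ('a, 'n::finite) chart set \<Rightarrow> bool" where
  "smooth_manifold X \<A> \<longleftrightarrow>
     Hausdorff_space X \<and> second_countable X \<and>
     (\<Union>c\<in>\<A>. chart_dom c) = topspace X \<and>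
     (\<forall>c\<in>\<A>. openin X (chart_dom c) \<and> open (chart_img c) \<and>
        homeomorphic_map (subtopology X (chart_dom c)) (top_of_set (chart_img c)) (snd c)) \<and>
     (\<forall>c\<in>\<A>. \<forall>d\<in>\<A>. smooth_on (overlap c d) (transition c d))"

text \<open>A tangent vector at \<open>p\<close> is the family of its components in the charts around \<open>p\<close>, which
  transform by the differentials of the transition maps. The components in charts not
  containing \<open>p\<close> are set to \<open>0\<close>, so that equality of tangent vectors is equality of families.\<close>

type_synonym ('a, 'n) tvec = "('a, 'n) chart \<Rightarrow> real^'n"

definition tangent_space :: "('a, 'n::finite) chart set \<Rightarrow> 'a \<Rightarrow> ('a, 'n) tvec set" where
  "tangent_space \<A> p = {v.
     (\<forall>c. c \<notin> \<A> \<or> p \<notin> chart_dom c \<longrightarrow> v c = 0) \<and>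
     (\<forall>c\<in>\<A>. \<forall>d\<in>\<A>. p \<in> chart_dom c \<and> p \<in> chart_dom d \<longrightarrow>
        v d = frechet_derivative (transition c d) (at (snd c p)) (v c))}"

text \<open>The tangent vector \<open>y\<^sup>i \<partial>/\<partial>x\<^sup>i\<close> at the point with coordinates \<open>x\<close> in the chart \<open>c\<close>.\<close>

definition coord_vec ::
    "('a, 'n::finite) chart set \<Rightarrow> ('a, 'n) chart \<Rightarrow> real^'n \<Rightarrow> real^'n \<Rightarrow> ('a, 'n) tvec" where
  "coord_vec \<A> c x y = (\<lambda>d. if d \<in> \<A> \<and> chart_inv c x \<in> chart_dom d
     then frechet_derivative (transition c d) (at x) y else 0)"

definition slit :: "('a, 'n::finite) chart \<Rightarrow> ((real^'n) \<times> (real^'n)) set" where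
  "slit c = chart_img c \<times> (UNIV - {0})"


section \<open>Finsler functions and the associated local quantities\<close>

text \<open>Below, \<open>L\<close> is the expression of a Finsler function in natural coordinates \<open>(x, y)\<close>.\<close>

abbreviation pd_x :: "'n::finite \<Rightarrow> ((real^'n) \<times> (real^'n) \<Rightarrow> real) \<Rightarrow> (real^'n) \<times> (real^'n) \<Rightarrow> real" where
  "pd_x k f z \<equiv> frechet_derivative f (at z) (axis k 1, 0)"

abbreviation pd_y :: "'n::finite \<Rightarrow> ((real^'n) \<times> (real^'n) \<Rightarrow> real) \<Rightarrow> (real^'n) \<times> (real^'n) \<Rightarrow> real" where
  "pd_y k f z \<equiv> frechet_derivative f (at z) (0, axis k 1)"

definition fund :: "((real^'n::finite) \<times> (real^'n) \<Rightarrow> real) \<Rightarrow> 'n \<Rightarrow> 'n \<Rightarrow> (real^'n) \<times> (real^'n) \<Rightarrow> real" where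
  "fund L i j = (\<lambda>z. 1/2 * pd_y i (pd_y j (\<lambda>w. (L w)\<^sup>2)) z)"

definition fund_inv :: "((real^'n::finite) \<times> (real^'n) \<Rightarrow> real) \<Rightarrow> 'n \<Rightarrow> 'n \<Rightarrow> (real^'n) \<times> (real^'n) \<Rightarrow> real" where
  "fund_inv L i j z = matrix_inv (\<chi> a b. fund L a b z) $ i $ j"

definition cartan :: "((real^'n::finite) \<times> (real^'n) \<Rightarrow> real) \<Rightarrow> 'n \<Rightarrow> 'n \<Rightarrow> 'n \<Rightarrow> (real^'n) \<times> (real^'n) \<Rightarrow> real" where
  "cartan L i j k z = L z / 2 * pd_y k (fund L i j) z"

definition cartan_up :: "((real^'n::finite) \<times> (real^'n) \<Rightarrow> real) \<Rightarrow> 'n \<Rightarrow> 'n \<Rightarrow> 'n \<Rightarrow> (real^'n) \<times> (real^'n) \<Rightarrow> real" where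
  "cartan_up L i j k z = (\<Sum>l\<in>UNIV. fund_inv L i l z * cartan L l j k z)"

definition formal_christoffel ::
    "((real^'n::finite) \<times> (real^'n) \<Rightarrow> real) \<Rightarrow> 'n \<Rightarrow> 'n \<Rightarrow> 'n \<Rightarrow> (real^'n) \<times> (real^'n) \<Rightarrow> real" where
  "formal_christoffel L i j k z = 1/2 * (\<Sum>s\<in>UNIV. fund_inv L i s z *
     (pd_x k (fund L s j) z - pd_x s (fund L j k) z + pd_x j (fund L s k) z))"

definition nonlin :: "((real^'n::finite) \<times> (real^'n) \<Rightarrow> real) \<Rightarrow> 'n \<Rightarrow> 'n \<Rightarrow> (real^'n) \<times> (real^'n) \<Rightarrow> real" where
  "nonlin L i j z = L z *
     ((\<Sum>k\<in>UNIV. formal_christoffel L i j k z * (snd z $ k / L z)) -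
      (\<Sum>k\<in>UNIV. \<Sum>r\<in>UNIV. \<Sum>s\<in>UNIV. cartan_up L i j k z * formal_christoffel L k r s z *
          (snd z $ r / L z) * (snd z $ s / L z)))"

text \<open>A Finsler function takes a point and a tangent vector at that point.\<close>

type_synonym ('a, 'n) finsler_fun = "'a \<Rightarrow> ('a, 'n) tvec \<Rightarrow> real"

definition fin_coord ::
    "('a, 'n::finite) chart set \<Rightarrow> ('a, 'n) finsler_fun \<Rightarrow> ('a, 'n) chart \<Rightarrow> (real^'n) \<times> (real^'n) \<Rightarrow> real" where
  "fin_coord \<A> F c = (\<lambda>(x, y). F (chart_inv c x) (coord_vec \<A> c x y))"

definition finsler_space ::
    "'a topology \<Rightarrow> ('a, 'n::finite) chart set \<Rightarrow> ('a, 'n) finsler_fun \<Rightarrow> bool" where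
  "finsler_space X \<A> F \<longleftrightarrow> smooth_manifold X \<A> \<and>
     (\<forall>p\<in>topspace X. \<forall>v\<in>tangent_space \<A> p. F p v \<ge> 0) \<and>
     (\<forall>p\<in>topspace X. \<forall>v\<in>tangent_space \<A> p. \<forall>r\<ge>0. F p (\<lambda>c. r *\<^sub>R v c) = r * F p v) \<and>
     (\<forall>c\<in>\<A>. smooth_on (slit c) (fin_coord \<A> F c)) \<and>
     (\<forall>c\<in>\<A>. \<forall>z\<in>slit c. \<forall>\<xi>. \<xi> \<noteq> 0 \<longrightarrow>
        (\<Sum>i\<in>UNIV. \<Sum>j\<in>UNIV. fund (fin_coord \<A> F c) i j z * \<xi> $ i * \<xi> $ j) > 0)"


section \<open>Differential forms and connections\<close>

type_synonym 'e form1 = "'e \<Rightarrow> 'e \<Rightarrow> real"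

definition ext_d :: "'e::real_normed_vector form1 \<Rightarrow> 'e \<Rightarrow> 'e \<Rightarrow> 'e \<Rightarrow> real" where
  "ext_d \<alpha> z u v = frechet_derivative (\<lambda>w. \<alpha> w v) (at z) u - frechet_derivative (\<lambda>w. \<alpha> w u) (at z) v"

definition wedge :: "'e form1 \<Rightarrow> 'e form1 \<Rightarrow> 'e \<Rightarrow> 'e \<Rightarrow> 'e \<Rightarrow> real" where
  "wedge \<alpha> \<beta> z u v = \<alpha> z u * \<beta> z v - \<alpha> z v * \<beta> z u"

text \<open>A linear connection on the pull-back bundle is given by its matrices of connection 1-forms
  in the natural coordinates of each chart, with respect to the frame \<open>\<partial>/\<partial>x\<^sup>j\<close>:
  \<open>\<omega> c z u $ i $ j\<close> is \<open>\<omega>\<^sup>i\<^sub>j\<close> at \<open>z = (x, y)\<close> applied to the vector \<open>u\<close> tangent to the slit bundle,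
  and \<open>\<nabla>(\<partial>/\<partial>x\<^sup>j) = \<omega>\<^sup>i\<^sub>j \<otimes> \<partial>/\<partial>x\<^sup>i\<close>.\<close>

type_synonym ('a, 'n) pb_conn =
  "('a, 'n) chart \<Rightarrow> (real^'n) \<times> (real^'n) \<Rightarrow> (real^'n) \<times> (real^'n) \<Rightarrow> real^'n^'n"

definition nat_transition ::
    "('a, 'n::finite) chart \<Rightarrow> ('a, 'n) chart \<Rightarrow> (real^'n) \<times> (real^'n) \<Rightarrow> (real^'n) \<times> (real^'n)" where
  "nat_transition c d = (\<lambda>(x, y). (transition c d x, frechet_derivative (transition c d) (at x) y))"

definition trans_jac :: "('a, 'n::finite) chart \<Rightarrow> ('a, 'n) chart \<Rightarrow> real^'n \<Rightarrow> real^'n^'n" where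
  "trans_jac c d x = jacobian (transition c d) (at x)"

text \<open>With \<open>T\<close> the Jacobian matrix of the change of coordinates and \<open>\<omega>'\<close> the connection matrix in the
  new coordinates, the change of frame formula reads \<open>T \<omega> = dT + \<omega>' T\<close>.\<close>

definition pullback_connection :: "('a, 'n::finite) chart set \<Rightarrow> ('a, 'n) pb_conn \<Rightarrow> bool" where
  "pullback_connection \<A> \<omega> \<longleftrightarrow>
     (\<forall>c\<in>\<A>. \<forall>z\<in>slit c. linear (\<omega> c z)) \<and>
     (\<forall>c\<in>\<A>. \<forall>u. smooth_on (slit c) (\<lambda>z. \<omega> c z u)) \<and>
     (\<forall>c\<in>\<A>. \<forall>d\<in>\<A>. \<forall>z\<in>slit c. fst z \<in> overlap c d \<longrightarrow> (\<forall>u.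
        trans_jac c d (fst z) ** \<omega> c z u =
        frechet_derivative (\<lambda>w. trans_jac c d (fst w)) (at z) u +
        \<omega> d (nat_transition c d z) (frechet_derivative (nat_transition c d) (at z) u)
          ** trans_jac c d (fst z)))"

definition delta_y :: "((real^'n::finite) \<times> (real^'n) \<Rightarrow> real) \<Rightarrow> 'n \<Rightarrow> ((real^'n) \<times> (real^'n)) form1" where
  "delta_y L i z u = snd u $ i + (\<Sum>j\<in>UNIV. nonlin L i j z * fst u $ j)"

definition chern_rund_connection ::
    "('a, 'n::finite) chart set \<Rightarrow> ('a, 'n) finsler_fun \<Rightarrow> ('a, 'n) pb_conn \<Rightarrow> bool" where
  "chern_rund_connection \<A> F \<omega> \<longleftrightarrow> pullback_connection \<A> \<omega> \<and>
     (\<forall>c\<in>\<A>. \<forall>z\<in>slit c.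
        let L = fin_coord \<A> F c; dx = (\<lambda>i w u. fst u $ i); om = (\<lambda>i j w u. \<omega> c w u $ i $ j) in
        (\<forall>i u v. ext_d (dx i) z u v - (\<Sum>j\<in>UNIV. wedge (dx j) (om i j) z u v) = 0) \<and>
        (\<forall>i j u. frechet_derivative (fund L i j) (at z) u
            - (\<Sum>k\<in>UNIV. fund L k j z * om k i z u) - (\<Sum>k\<in>UNIV. fund L i k z * om k j z u)
          = (\<Sum>k\<in>UNIV. 2 * cartan L i j k z * (delta_y L k z u / L z))))"

text \<open>The coefficients \<open>\<Gamma>\<^sup>i\<^sub>j\<^sub>k(x, y)\<close> of \<open>dx\<^sup>k\<close> in \<open>\<omega>\<^sup>i\<^sub>j\<close>.\<close>

definition conn_coeff ::
    "('a, 'n::finite) pb_conn \<Rightarrow> ('a, 'n) chart \<Rightarrow> 'n \<Rightarrow> 'n \<Rightarrow> 'n \<Rightarrow> real^'n \<Rightarrow> real^'n \<Rightarrow> real" where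
  "conn_coeff \<omega> c i j k x y = \<omega> c (x, y) (axis k 1, 0) $ i $ j"

definition berwald_space ::
    "'a topology \<Rightarrow> ('a, 'n::finite) chart set \<Rightarrow> ('a, 'n) finsler_fun \<Rightarrow> bool" where
  "berwald_space X \<A> F \<longleftrightarrow> finsler_space X \<A> F \<and>
     (\<exists>\<omega>. chern_rund_connection \<A> F \<omega> \<and>
        (\<forall>c\<in>\<A>. \<forall>x\<in>chart_img c. \<forall>y y'. y \<noteq> 0 \<and> y' \<noteq> 0 \<longrightarrow>
           (\<forall>i j k. conn_coeff \<omega> c i j k x y = conn_coeff \<omega> c i j k x y')))"

text \<open>An affine connection on the manifold is likewise given by its connection 1-forms:
  \<open>D c x \<xi> $ i $ j = \<Gamma>\<^sup>i\<^sub>j\<^sub>k(x) \<xi>\<^sup>k\<close>.\<close>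

type_synonym ('a, 'n) aff_conn = "('a, 'n) chart \<Rightarrow> real^'n \<Rightarrow> real^'n \<Rightarrow> real^'n^'n"

definition affine_connection :: "('a, 'n::finite) chart set \<Rightarrow> ('a, 'n) aff_conn \<Rightarrow> bool" where
  "affine_connection \<A> D \<longleftrightarrow>
     (\<forall>c\<in>\<A>. \<forall>x\<in>chart_img c. linear (D c x)) \<and>
     (\<forall>c\<in>\<A>. \<forall>\<xi>. smooth_on (chart_img c) (\<lambda>x. D c x \<xi>)) \<and>
     (\<forall>c\<in>\<A>. \<forall>d\<in>\<A>. \<forall>x\<in>overlap c d. \<forall>\<xi>.
        trans_jac c d x ** D c x \<xi> =
        frechet_derivative (trans_jac c d) (at x) \<xi> +
        D d (transition c d x) (frechet_derivative (transition c d) (at x) \<xi>) ** trans_jac c d x)"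

text \<open>The affine connection with coefficients \<open>\<Gamma>\<^sup>i\<^sub>j\<^sub>k(x)\<close>, for a connection on the pull-back bundle whose
  coefficients do not depend on \<open>y\<close>. Only meaningful in that case.\<close>

definition descended_connection :: "('a, 'n::finite) pb_conn \<Rightarrow> ('a, 'n) aff_conn" where
  "descended_connection \<omega> c x \<xi> =
     (\<chi> i j. \<Sum>k\<in>UNIV. (THE G. \<forall>y. y \<noteq> 0 \<longrightarrow> conn_coeff \<omega> c i j k x y = G) * \<xi> $ k)"


section \<open>Holonomy\<close>

definition partition01 :: "real set \<Rightarrow> bool" where
  "partition01 S \<longleftrightarrow> finite S \<and> {0, 1} \<subseteq> S \<and> S \<subseteq> {0..1}"

definition pieces :: "real set \<Rightarrow> (real \<times> real) set" where
  "pieces S = {(a, b). a \<in> S \<and> b \<in> S \<and> a < b \<and> S \<inter> {a<..<b} = {}}"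

text \<open>On every piece \<open>[a, b]\<close>, the curve is smooth up to the end points (one-sided derivatives of all
  orders); \<open>g k\<close> is the \<open>k\<close>-th derivative of the coordinate expression of the curve.\<close>

definition piecewise_smooth_curve ::
    "'a topology \<Rightarrow> ('a, 'n::finite) chart set \<Rightarrow> real set \<Rightarrow> (real \<Rightarrow> 'a) \<Rightarrow> bool" where
  "piecewise_smooth_curve X \<A> S \<gamma> \<longleftrightarrow> partition01 S \<and> pathin X \<gamma> \<and>
     (\<forall>(a, b)\<in>pieces S. \<forall>c\<in>\<A>. \<exists>g :: nat \<Rightarrow> real \<Rightarrow> real^'n.
        \<forall>t\<in>{a..b}. \<gamma> t \<in> chart_dom c \<longrightarrow>
          g 0 t = snd c (\<gamma> t) \<and>
          (\<forall>k. (g k has_vector_derivative g (Suc k) t) (at t within {a..b})))"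

text \<open>The parallel transport equation \<open>dV\<^sup>i/dt = - \<Gamma>\<^sup>i\<^sub>j\<^sub>k V\<^sup>j d\<gamma>\<^sup>k/dt\<close>. The field is single-valued at the
  break points, hence continuous there.\<close>

definition parallel_along ::
    "('a, 'n::finite) chart set \<Rightarrow> ('a, 'n) aff_conn \<Rightarrow> real set \<Rightarrow> (real \<Rightarrow> 'a) \<Rightarrow>
     (real \<Rightarrow> ('a, 'n) tvec) \<Rightarrow> bool" where
  "parallel_along \<A> D S \<gamma> V \<longleftrightarrow>
     (\<forall>t\<in>{0..1}. V t \<in> tangent_space \<A> (\<gamma> t)) \<and>
     (\<forall>(a, b)\<in>pieces S. \<forall>c\<in>\<A>. \<forall>t\<in>{a..b}. \<gamma> t \<in> chart_dom c \<longrightarrow>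
        ((\<lambda>s. V s c) has_vector_derivative
           - (D c (snd c (\<gamma> t)) (vector_derivative (\<lambda>s. snd c (\<gamma> s)) (at t within {a..b})) *v V t c))
          (at t within {a..b}))"

definition parallel_transport ::
    "'a topology \<Rightarrow> ('a, 'n::finite) chart set \<Rightarrow> ('a, 'n) aff_conn \<Rightarrow> (real \<Rightarrow> 'a) \<Rightarrow>
     ('a, 'n) tvec \<Rightarrow> ('a, 'n) tvec" where
  "parallel_transport X \<A> D \<gamma> = (\<lambda>v\<in>tangent_space \<A> (\<gamma> 0). THE w. \<exists>S V.
     piecewise_smooth_curve X \<A> S \<gamma> \<and> parallel_along \<A> D S \<gamma> V \<and> V 0 = v \<and> V 1 = w)"

text \<open>The holonomy group at \<open>p\<close>, as a group of transformations of the tangent space at \<open>p\<close>.\<close>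

definition holonomy_group ::
    "'a topology \<Rightarrow> ('a, 'n::finite) chart set \<Rightarrow> ('a, 'n) aff_conn \<Rightarrow> 'a \<Rightarrow>
     (('a, 'n) tvec \<Rightarrow> ('a, 'n) tvec) monoid" where
  "holonomy_group X \<A> D p = BijGroup (tangent_space \<A> p)
     \<lparr>carrier := {parallel_transport X \<A> D \<gamma> | \<gamma>.
        (\<exists>S. piecewise_smooth_curve X \<A> S \<gamma>) \<and> \<gamma> 0 = p \<and> \<gamma> 1 = p}\<rparr>"


section \<open>Riemannian metrics\<close>

type_synonym ('a, 'n) metric_field = "'a \<Rightarrow> ('a, 'n) tvec \<Rightarrow> ('a, 'n) tvec \<Rightarrow> real"

definition metric_coord ::
    "('a, 'n::finite) chart set \<Rightarrow> ('a, 'n) metric_field \<Rightarrow> ('a, 'n) chart \<Rightarrow> 'n \<Rightarrow> 'n \<Rightarrow> real^'n \<Rightarrow> real" where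
  "metric_coord \<A> h c i j x =
     h (chart_inv c x) (coord_vec \<A> c x (axis i 1)) (coord_vec \<A> c x (axis j 1))"

definition riemannian_metric ::
    "'a topology \<Rightarrow> ('a, 'n::finite) chart set \<Rightarrow> ('a, 'n) metric_field \<Rightarrow> bool" where
  "riemannian_metric X \<A> h \<longleftrightarrow>
     (\<forall>p\<in>topspace X. \<forall>u\<in>tangent_space \<A> p. \<forall>v\<in>tangent_space \<A> p. \<forall>w\<in>tangent_space \<A> p. \<forall>a b.
        h p (\<lambda>c. a *\<^sub>R u c + b *\<^sub>R v c) w = a * h p u w + b * h p v w) \<and>
     (\<forall>p\<in>topspace X. \<forall>u\<in>tangent_space \<A> p. \<forall>v\<in>tangent_space \<A> p. h p u v = h p v u) \<and>
     (\<forall>p\<in>topspace X. \<forall>u\<in>tangent_space \<A> p. u \<noteq> (\<lambda>c. 0) \<longrightarrow> h p u u > 0) \<and>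
     (\<forall>c\<in>\<A>. \<forall>i j. smooth_on (chart_img c) (metric_coord \<A> h c i j))"

definition levi_civita_connection ::
    "('a, 'n::finite) chart set \<Rightarrow> ('a, 'n) metric_field \<Rightarrow> ('a, 'n) aff_conn \<Rightarrow> bool" where
  "levi_civita_connection \<A> h D \<longleftrightarrow> affine_connection \<A> D \<and>
     (\<forall>c\<in>\<A>. \<forall>x\<in>chart_img c.
        let H = metric_coord \<A> h c; dx = (\<lambda>i w \<xi>. \<xi> $ i); om = (\<lambda>i j w \<xi>. D c w \<xi> $ i $ j) in
        (\<forall>i \<xi> \<eta>. ext_d (dx i) x \<xi> \<eta> - (\<Sum>j\<in>UNIV. wedge (dx j) (om i j) x \<xi> \<eta>) = 0) \<and>
        (\<forall>i j \<xi>. frechet_derivative (H i j) (at x) \<xi>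
            - (\<Sum>k\<in>UNIV. H k j x * om k i x \<xi>) - (\<Sum>k\<in>UNIV. H i k x * om k j x \<xi>) = 0))"

end

theory Submission
  imports Defs
begin

text \<open>Write \<open>\<Gamma>\<close> for the coefficients of the connection, which depend on the base point only. The theorem is
obtained in Szabo's form: there is a Riemannian metric whose Levi-Civita connection is the descended
connection itself, so that the two holonomy groups are one and the same object.

Contracting the compatibility condition of the Chern-Rund connection with \<open>y\<^sup>i y\<^sup>j\<close> removes the
Cartan tensor, because \<open>g\<^sub>i\<^sub>j\<close> is homogeneous of degree 0 in \<open>y\<close>. What remains
(\<open>energy_horizontal_derivative\<close>, \<open>fin_coord_horizontal\<close>) says that the derivative of the Finsler
function in a horizontal direction vanishes: moving the base point by \<open>\<xi>\<close> changes \<open>F\<close> to first order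
exactly as the linear map \<open>I + \<Gamma>\<^sub>\<xi>\<close> of the fibre does. Hence every inner product that is attached to the
functions \<open>F(x, \<cdot>)\<close> in a linearly natural way is parallel.

The inner product used here is the covariance form of the polar body
\<open>K = {\<xi>. \<forall>y. \<xi>(y) \<le> F(x, y)}\<close>, that is, \<open>h(u, v)\<close> is the mean of \<open>\<xi>(u) \<xi>(v)\<close> over \<open>\<xi> \<in> K\<close>. A linear
bijection multiplies Lebesgue measure by a constant, which cancels in the mean; this gives the naturality
\<open>body_form_compose\<close>, and with it the independence of the chart (\<open>averaged_metric_chart\<close>).

The derivative of \<open>h\<close> in \<open>x\<close> is found without parallel transport and without differentiation under an
integral. By compactness of the unit sphere, \<open>F(x + \<xi>, y)\<close> and \<open>F(x, y + \<Gamma>\<^sub>\<xi> y)\<close> have ratio \<open>1 + o(\<xi>)\<close>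
uniformly in \<open>y\<close>. Polar bodies are monotone in the function and scale with it, so the covariance forms
also have ratio \<open>1 + o(\<xi>)\<close> (\<open>body_form_perturb\<close>), while naturality computes the form of
\<open>y \<mapsto> F(x, y + \<Gamma>\<^sub>\<xi> y)\<close> exactly. The result \<open>body_form_has_derivative\<close> is the metric condition for \<open>h\<close>.
This condition is also a first order linear system for \<open>h\<close> with smooth coefficients, whence \<open>h\<close> is smooth.
The torsion condition is the one of the Chern-Rund connection.

The definition of a Berwald space provides some Chern-Rund connection with coefficients independent of
\<open>y\<close>; by uniqueness (\<open>chern_rund_unique\<close>) it has the same coefficients as the given one.\<close>

section \<open>Linear bijections and Lebesgue measure\<close>

lemma nn_integral_lborel_translate:
  fixes f :: "'e::euclidean_space \<Rightarrow> ennreal"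
  assumes [measurable]: "f \<in> borel_measurable borel"
  shows "(\<integral>\<^sup>+z. f (a + z) \<partial>lborel) = (\<integral>\<^sup>+z. f z \<partial>lborel)"
proof -
  have "(\<integral>\<^sup>+z. f z \<partial>lborel) = (\<integral>\<^sup>+z. f z \<partial>distr lborel borel ((+) a))"
    by (simp add: lborel_distr_plus)
  also have "\<dots> = (\<integral>\<^sup>+z. f (a + z) \<partial>lborel)"
    by (subst nn_integral_distr) auto
  finally show ?thesis by simp
qed

lemma nn_integral_lborel_reflect:
  fixes f :: "'e::euclidean_space \<Rightarrow> ennreal"
  assumes [measurable]: "f \<in> borel_measurable borel"
  shows "(\<integral>\<^sup>+z. f (a - z) \<partial>lborel) = (\<integral>\<^sup>+z. f z \<partial>lborel)"
proof -
  have eq: "lborel = density (distr lborel borel (\<lambda>x::'e. a + (-1) *\<^sub>R x)) (\<lambda>_. ennreal (\<bar>-1\<bar>^DIM('e)))"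
    by (rule lborel_affine) simp
  have "(\<integral>\<^sup>+z. f z \<partial>lborel) = (\<integral>\<^sup>+z. f z \<partial>density (distr lborel borel (\<lambda>x::'e. a + (-1) *\<^sub>R x)) (\<lambda>_. ennreal (\<bar>-1\<bar>^DIM('e))))"
    using eq by simp
  also have "\<dots> = (\<integral>\<^sup>+z. f (a - z) \<partial>lborel)"
    by (simp add: density_1 nn_integral_distr)
  finally show ?thesis by simp
qed

text \<open>This is the uniqueness of Haar measure for the two translation invariant functionals \<open>f \<mapsto> \<integral> f\<close> and
\<open>f \<mapsto> \<integral> f \<circ> T\<close>: by Fubini and invariance under translations and reflections, both sides are equal to
\<open>\<integral>\<integral> f(T x) g(T x - z) dz dx\<close>. The factor between the functionals never has to be identified with a
determinant.\<close>

lemma nn_integral_lborel_linear_bijection: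
  fixes T T' :: "'e::euclidean_space \<Rightarrow> 'e" and f g :: "'e \<Rightarrow> ennreal"
  assumes lin: "linear T" "linear T'" and inv: "\<And>x. T (T' x) = x"
    and [measurable]: "f \<in> borel_measurable borel" "g \<in> borel_measurable borel"
  shows "(\<integral>\<^sup>+z. f z \<partial>lborel) * (\<integral>\<^sup>+x. g (T x) \<partial>lborel) = (\<integral>\<^sup>+x. f (T x) \<partial>lborel) * (\<integral>\<^sup>+z. g z \<partial>lborel)"
proof -
  have [measurable]: "T \<in> borel_measurable borel" "T' \<in> borel_measurable borel"
    using lin by (auto intro!: borel_measurable_continuous_onI linear_continuous_on
        simp: linear_conv_bounded_linear)
  have "(\<integral>\<^sup>+z. f z \<partial>lborel) * (\<integral>\<^sup>+x. g (T x) \<partial>lborel) =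
      (\<integral>\<^sup>+x. (\<integral>\<^sup>+z. f z \<partial>lborel) * g (T x) \<partial>lborel)"
    by (subst nn_integral_cmult) auto
  also have "\<dots> = (\<integral>\<^sup>+x. (\<integral>\<^sup>+z. f (T x + z) \<partial>lborel) * g (T x) \<partial>lborel)"
    by (subst nn_integral_lborel_translate) auto
  also have "\<dots> = (\<integral>\<^sup>+x. (\<integral>\<^sup>+z. f (T x + z) * g (T x) \<partial>lborel) \<partial>lborel)"
    by (subst nn_integral_multc) auto
  also have "\<dots> = (\<integral>\<^sup>+z. (\<integral>\<^sup>+x. f (T x + z) * g (T x) \<partial>lborel) \<partial>lborel)"
    by (rule lborel_pair.Fubini'[symmetric]) measurable
  also have "\<dots> = (\<integral>\<^sup>+z. (\<integral>\<^sup>+x. f (T x) * g (T x - z) \<partial>lborel) \<partial>lborel)"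
  proof (rule nn_integral_cong)
    fix z :: 'e
    \<comment> \<open>substitute \<open>x - T\<^sup>-\<^sup>1 z\<close> for \<open>x\<close>\<close>
    have "(\<integral>\<^sup>+x. f (T x + z) * g (T x) \<partial>lborel) =
        (\<integral>\<^sup>+x. f (T (- T' z + x) + z) * g (T (- T' z + x)) \<partial>lborel)"
      by (rule nn_integral_lborel_translate[symmetric, of "\<lambda>x. f (T x + z) * g (T x)"]) simp
    moreover have "T (- T' z + x) = T x - z" for x
      using lin inv by (simp add: linear_add linear_neg linear_diff)
    ultimately show "(\<integral>\<^sup>+x. f (T x + z) * g (T x) \<partial>lborel) = (\<integral>\<^sup>+x. f (T x) * g (T x - z) \<partial>lborel)"
      by simp
  qed
  also have "\<dots> = (\<integral>\<^sup>+x. (\<integral>\<^sup>+z. f (T x) * g (T x - z) \<partial>lborel) \<partial>lborel)"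
    by (rule lborel_pair.Fubini') measurable
  also have "\<dots> = (\<integral>\<^sup>+x. f (T x) * (\<integral>\<^sup>+z. g (T x - z) \<partial>lborel) \<partial>lborel)"
    by (subst nn_integral_cmult) auto
  also have "\<dots> = (\<integral>\<^sup>+x. f (T x) * (\<integral>\<^sup>+z. g z \<partial>lborel) \<partial>lborel)"
    by (subst nn_integral_lborel_reflect) auto
  also have "\<dots> = (\<integral>\<^sup>+x. f (T x) \<partial>lborel) * (\<integral>\<^sup>+z. g z \<partial>lborel)"
    by (subst nn_integral_multc) auto
  finally show ?thesis .
qed

lemma emeasure_lborel_bounded_open:
  fixes S :: "'e::euclidean_space set"
  assumes "open S" "bounded S" "S \<noteq> {}"
  obtains m where "m > 0" "emeasure lborel S = ennreal m"
proof -
  have "emeasure lborel S < \<infinity>" using assms(2) emeasure_bounded_finite by blast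
  moreover have "emeasure lborel S \<noteq> 0"
    using open_not_negligible[OF assms(1,3)] assms(1)
    by (auto simp: negligible_iff_null_sets null_sets_def)
  ultimately show ?thesis
    using that by (metis emeasure_eq_ennreal_measure ennreal_0 infinity_ennreal_def
        less_irrefl zero_less_measure_iff)
qed

text \<open>The factor is read off from the unit ball, whose measure and the measure of whose preimage are
positive and finite.\<close>

lemma lborel_linear_bijection:
  fixes T T' :: "'e::euclidean_space \<Rightarrow> 'e"
  assumes lin: "linear T" "linear T'" and inv: "\<And>x. T (T' x) = x" "\<And>x. T' (T x) = x"
  obtains c :: real where "c > 0" "distr lborel borel T = density lborel (\<lambda>_. ennreal c)"
proof -
  have bl: "bounded_linear T" "bounded_linear T'"
    using lin by (auto simp: linear_conv_bounded_linear)
  have [measurable]: "T \<in> borel_measurable borel"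
    using bl by (auto intro!: borel_measurable_continuous_onI linear_continuous_on)
  let ?B = "ball (0::'e) 1"
  have vim: "T -` ?B = T' ` ?B" using inv by (auto simp: image_iff intro!: bexI[of _ "T _"])
  have op: "open (T -` ?B)"
    by (rule open_vimage) (use bl linear_continuous_on in auto)
  have bo: "bounded (T -` ?B)" unfolding vim by (rule bounded_linear_image) (use bl in auto)
  have ne: "T -` ?B \<noteq> {}" using lin by (auto intro!: exI[of _ 0] simp: linear_0 vimage_def)
  obtain a where a: "a > 0" "emeasure lborel (T -` ?B) = ennreal a"
    using emeasure_lborel_bounded_open[OF op bo ne] .
  obtain b where b: "b > 0" "emeasure lborel ?B = ennreal b"
    by (rule emeasure_lborel_bounded_open[of ?B]) auto
  show ?thesis
  proof (rule that[of "a / b"])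
    show "a / b > 0" using a b by simp
    show "distr lborel borel T = density lborel (\<lambda>_. ennreal (a / b))"
    proof (rule measure_eqI)
      fix S assume "S \<in> sets (distr lborel borel T)"
      then have [measurable]: "S \<in> sets borel" by simp
      have [measurable]: "T -` S \<in> sets borel"
        using measurable_sets[of T borel borel S] by simp
      have *: "(\<integral>\<^sup>+z. indicator S z \<partial>lborel) * (\<integral>\<^sup>+x. indicator ?B (T x) \<partial>lborel) =
        (\<integral>\<^sup>+x. indicator S (T x) \<partial>lborel) * (\<integral>\<^sup>+z. indicator ?B z \<partial>lborel)"
        by (rule nn_integral_lborel_linear_bijection[OF lin inv(1)]) (auto intro!: borel_measurable_indicator)
      have i: "\<And>A x. indicator A (T x) = (indicator (T -` A) x :: ennreal)"
        by (auto simp: indicator_def)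
      have "emeasure lborel S * ennreal a = emeasure lborel (T -` S) * ennreal b"
        using * a b op by (simp add: i)
      then have "emeasure lborel S * ennreal a / ennreal b = emeasure lborel (T -` S)"
        using ennreal_mult_divide_eq[of "ennreal b" "emeasure lborel (T -` S)"] b by simp
      moreover have "ennreal (a / b) * emeasure lborel S = emeasure lborel S * ennreal a / ennreal b"
        using a b by (simp only: divide_ennreal[symmetric] less_imp_le ennreal_times_divide mult.commute)
      ultimately show "emeasure (distr lborel borel T) S = emeasure (density lborel (\<lambda>_. ennreal (a / b))) S"
        by (simp add: emeasure_distr emeasure_density_const)
    qed simp
  qed
qed

corollary lborel_integral_linear_bijection:
  fixes T T' :: "'e::euclidean_space \<Rightarrow> 'e"
  assumes lin: "linear T" "linear T'" and inv: "\<And>x. T (T' x) = x" "\<And>x. T' (T x) = x"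
  obtains c :: real where "c > 0"
    "\<And>q :: 'e \<Rightarrow> real. q \<in> borel_measurable borel \<Longrightarrow>
       (LINT x|lborel. q (T x)) = c * (LINT x|lborel. q x)"
proof -
  obtain c where c: "c > 0" "distr lborel borel T = density lborel (\<lambda>_. ennreal c)"
    by (rule lborel_linear_bijection[OF assms])
  have [measurable]: "T \<in> borel_measurable borel"
    using lin by (auto intro!: borel_measurable_continuous_onI linear_continuous_on
        simp: linear_conv_bounded_linear)
  have "(LINT x|lborel. q (T x)) = c * (LINT x|lborel. q x)"
    if [measurable]: "q \<in> borel_measurable borel" for q :: "'e \<Rightarrow> real"
  proof -
    have "(LINT x|lborel. q (T x)) = (LINT x|distr lborel borel T. q x)"
      by (subst integral_distr) auto
    also have "\<dots> = c * (LINT x|lborel. q x)"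
      unfolding c(2) using c(1) by (subst integral_density) auto
    finally show ?thesis .
  qed
  then show ?thesis using c that by blast
qed

section \<open>The covariance form of the polar body\<close>

text \<open>The properties of a norm that keep its dual unit ball bounded and bounded away from the origin.
Finsler functions need not be even, hence only non-negative factors.\<close>

definition gauge_like :: "('e::euclidean_space \<Rightarrow> real) \<Rightarrow> bool" where
  "gauge_like f \<longleftrightarrow> (\<forall>r\<ge>0. \<forall>y. f (r *\<^sub>R y) = r * f y) \<and>
     (\<exists>c>0. \<forall>y. c * norm y \<le> f y) \<and> (\<exists>C. \<forall>y. f y \<le> C * norm y)"

text \<open>For a norm this is the unit ball of the dual norm, with covectors identified with vectors by the
inner product.\<close>

definition polar_body :: "('e::euclidean_space \<Rightarrow> real) \<Rightarrow> 'e set" where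
  "polar_body f = {\<xi>. \<forall>y. \<xi> \<bullet> y \<le> f y}"

definition body_integral :: "('e::euclidean_space \<Rightarrow> real) \<Rightarrow> ('e \<Rightarrow> real) \<Rightarrow> real" where
  "body_integral f q = (LINT \<xi>|lborel. indicator (polar_body f) \<xi> * q \<xi>)"

text \<open>The second moments of the uniform distribution on the polar body. Averaging over the polar body rather
than over the unit ball makes this a form on vectors instead of covectors, so no inverse matrix has to
be differentiated later.\<close>

definition body_form :: "('e::euclidean_space \<Rightarrow> real) \<Rightarrow> 'e \<Rightarrow> 'e \<Rightarrow> real" where
  "body_form f u v = body_integral f (\<lambda>\<xi>. (\<xi> \<bullet> u) * (\<xi> \<bullet> v)) / body_integral f (\<lambda>_. 1)"

lemma closed_polar_body: "closed (polar_body f)"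
proof -
  have "polar_body f = (\<Inter>y. {\<xi>. \<xi> \<bullet> y \<le> f y})" by (auto simp: polar_body_def)
  also have "closed \<dots>" by (auto simp: inner_commute[of _ y for y] intro!: closed_halfspace_le)
  finally show ?thesis .
qed

lemma polar_body_subset_cball:
  assumes "\<And>y. f y \<le> C * norm y"
  shows "polar_body f \<subseteq> cball 0 C"
proof
  fix \<xi> assume "\<xi> \<in> polar_body f"
  then have "\<xi> \<bullet> \<xi> \<le> C * norm \<xi>" using assms[of \<xi>] unfolding polar_body_def
    by (smt (verit) mem_Collect_eq)
  then have "norm \<xi> * norm \<xi> \<le> C * norm \<xi>" by (simp add: dot_square_norm power2_eq_square)
  moreover have "C \<ge> 0"
  proof -
    obtain b :: 'a where "b \<in> Basis" using nonempty_Basis by blast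
    have "\<xi> \<bullet> b \<le> C * norm b" "\<xi> \<bullet> (-b) \<le> C * norm (-b)"
      using \<open>\<xi> \<in> polar_body f\<close> assms unfolding polar_body_def
      by (auto intro: order_trans simp del: norm_minus_cancel inner_minus_right)
    then show ?thesis using \<open>b \<in> Basis\<close> by simp
  qed
  ultimately show "\<xi> \<in> cball 0 C" by (cases "\<xi> = 0") auto
qed

lemma cball_subset_polar_body:
  assumes "\<And>y. c * norm y \<le> f y"
  shows "cball 0 c \<subseteq> polar_body f"
proof
  fix \<xi> :: 'a assume "\<xi> \<in> cball 0 c"
  then show "\<xi> \<in> polar_body f"
    unfolding polar_body_def
    by (auto intro!: order_trans[OF norm_cauchy_schwarz] order_trans[OF mult_right_mono assms])
qed

lemma compact_polar_body: "gauge_like f \<Longrightarrow> compact (polar_body f)"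
  by (meson bounded_cball bounded_subset closed_polar_body compact_eq_bounded_closed
      gauge_like_def polar_body_subset_cball)

lemma body_integrable:
  assumes "gauge_like f" "continuous_on UNIV q"
  shows "integrable lborel (\<lambda>\<xi>. indicator (polar_body f) \<xi> * (q \<xi> :: real))"
  using borel_integrable_compact[OF compact_polar_body[OF assms(1)], of q] assms(2)
  by (auto intro: continuous_on_subset)

lemma body_integral_mono:
  assumes "gauge_like f" "gauge_like g" "\<And>y. f y \<le> g y"
    "continuous_on UNIV q" "\<And>\<xi>. 0 \<le> q \<xi>"
  shows "body_integral f q \<le> body_integral g q"
  unfolding body_integral_def
  by (intro integral_mono body_integrable assms)
    (use assms in \<open>auto simp: indicator_def polar_body_def intro: order_trans\<close>)

lemma body_integral_pos:
  assumes f: "gauge_like f" and q: "continuous_on UNIV q" "\<And>\<xi>. 0 \<le> q \<xi>"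
    and e: "e > 0" "\<And>\<xi>. \<xi> \<in> ball a r \<Longrightarrow> e \<le> q \<xi>" and r: "r > 0" "ball a r \<subseteq> polar_body f"
  shows "body_integral f q > 0"
proof -
  obtain m where m: "m > 0" "emeasure lborel (ball a r) = ennreal m"
    by (rule emeasure_lborel_bounded_open[of "ball a r"]) (use r in auto)
  have "integrable lborel (indicator (ball a r) :: 'a \<Rightarrow> real)"
    by (rule integrable_real_indicator) (use m in auto)
  then have int: "integrable lborel (\<lambda>\<xi>. indicator (ball a r) \<xi> * e)"
    by (rule integrable_mult_left)
  have "0 < e * measure lborel (ball a r)" using m e by (simp add: measure_def)
  also have "\<dots> = (LINT \<xi>|lborel. indicator (ball a r) \<xi> * e)" by simp
  also have "\<dots> \<le> body_integral f q"
    unfolding body_integral_def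
    by (intro integral_mono int body_integrable f q)
      (use e q r in \<open>auto simp: indicator_def\<close>)
  finally show ?thesis .
qed

lemma body_volume_pos:
  assumes "gauge_like f" shows "body_integral f (\<lambda>_. 1) > 0"
proof -
  obtain c where c: "c > 0" "\<And>y. c * norm y \<le> f y" using assms by (auto simp: gauge_like_def)
  show ?thesis
    by (rule body_integral_pos[OF assms, of _ 1 0 c])
      (use c cball_subset_polar_body[of c f] in \<open>auto simp: subset_iff\<close>)
qed

lemma body_form_sym: "body_form f u v = body_form f v u"
  by (simp add: body_form_def mult.commute)

lemma body_form_linear:
  assumes "gauge_like f"
  shows "body_form f (a *\<^sub>R u + b *\<^sub>R v) w = a * body_form f u w + b * body_form f v w"
proof -
  have int: "\<And>u v. integrable lborel (\<lambda>\<xi>. indicator (polar_body f) \<xi> * ((\<xi> \<bullet> u) * (\<xi> \<bullet> v)))"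
    by (intro body_integrable assms continuous_intros)
  have "body_integral f (\<lambda>\<xi>. (\<xi> \<bullet> (a *\<^sub>R u + b *\<^sub>R v)) * (\<xi> \<bullet> w)) =
    (LINT \<xi>|lborel. a * (indicator (polar_body f) \<xi> * ((\<xi> \<bullet> u) * (\<xi> \<bullet> w))) +
       b * (indicator (polar_body f) \<xi> * ((\<xi> \<bullet> v) * (\<xi> \<bullet> w))))"
    unfolding body_integral_def by (rule arg_cong[of _ _ "integral\<^sup>L lborel"]) (auto simp: fun_eq_iff algebra_simps)
  also have "\<dots> = a * body_integral f (\<lambda>\<xi>. (\<xi> \<bullet> u) * (\<xi> \<bullet> w)) + b * body_integral f (\<lambda>\<xi>. (\<xi> \<bullet> v) * (\<xi> \<bullet> w))"
    unfolding body_integral_def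
    by (subst Bochner_Integration.integral_add) (auto intro!: integrable_mult_right int)
  finally show ?thesis by (simp add: body_form_def add_divide_distrib)
qed

lemma body_form_polarization:
  assumes "gauge_like f"
  shows "body_form f u v = (body_form f (u + v) (u + v) - body_form f u u - body_form f v v) / 2"
proof -
  have add: "body_form f (p + q) w = body_form f p w + body_form f q w" for p q w
    using body_form_linear[OF assms, of 1 p 1 q w] by simp
  show ?thesis
    using add[of u v "u + v"] add[of u v u] add[of u v v] body_form_sym[of f u "u + v"]
      body_form_sym[of f v "u + v"] body_form_sym[of f u v]
    by simp
qed

text \<open>The polar body contains a small ball on which \<open>\<xi> \<bullet> u\<close> is bounded away from zero.\<close>

lemma body_form_pos:
  fixes u :: "'e::euclidean_space"
  assumes f: "gauge_like f" and u: "u \<noteq> 0"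
  shows "body_form f u u > 0"
proof -
  obtain c where c: "c > 0" "\<And>y. c * norm y \<le> f y" using f by (auto simp: gauge_like_def)
  \<comment> \<open>the ball of radius \<open>c / 4\<close> about \<open>a\<close> lies in the ball of radius \<open>c\<close>, hence in the polar body\<close>
  define a where "a = (c / 2 / norm u) *\<^sub>R u"
  have na: "norm a = c / 2" using u c by (simp add: a_def)
  have au: "a \<bullet> u = c / 2 * norm u" using u by (simp add: a_def dot_square_norm power2_eq_square)
  have "body_integral f (\<lambda>\<xi>. (\<xi> \<bullet> u) * (\<xi> \<bullet> u)) > 0"
  proof (rule body_integral_pos[OF f, of _ "(c / 4 * norm u)^2" a "c/4"])
    show "0 < (c / 4 * norm u)\<^sup>2" using c u by simp
    show "(c / 4 * norm u)\<^sup>2 \<le> (\<xi> \<bullet> u) * (\<xi> \<bullet> u)" if "\<xi> \<in> ball a (c / 4)" for \<xi>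
    proof -
      have "\<bar>(\<xi> - a) \<bullet> u\<bar> \<le> norm (\<xi> - a) * norm u" by (rule Cauchy_Schwarz_ineq2)
      also have "\<dots> \<le> c / 4 * norm u"
        using that by (intro mult_right_mono) (auto simp: dist_norm norm_minus_commute)
      finally have "c / 4 * norm u \<le> \<xi> \<bullet> u" using au inner_diff_left[of \<xi> a u] by linarith
      moreover have "0 \<le> c / 4 * norm u" using c by simp
      ultimately show ?thesis unfolding power2_eq_square by (intro mult_mono) linarith+
    qed
    have "ball a (c / 4) \<subseteq> cball 0 c"
    proof
      fix x assume "x \<in> ball a (c/4)"
      then show "x \<in> cball 0 c" using norm_triangle_ineq[of "x - a" a] na c
        by (auto simp: dist_norm norm_minus_commute)
    qed
    then show "ball a (c / 4) \<subseteq> polar_body f" using cball_subset_polar_body[of c f] c by blast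
  qed (use c in \<open>auto intro!: continuous_intros\<close>)
  then show ?thesis using body_volume_pos[OF f] by (simp add: body_form_def)
qed

lemma body_form_upper:
  fixes f :: "'e::euclidean_space \<Rightarrow> real"
  assumes f: "gauge_like f"
  obtains N where "N \<ge> 0" "\<And>u. body_form f u u \<le> N * (norm u)\<^sup>2"
proof -
  obtain C where C: "\<And>y. f y \<le> C * norm y" using f by (auto simp: gauge_like_def)
  have "body_form f u u \<le> C\<^sup>2 * (norm u)\<^sup>2" for u :: 'e
  proof -
    have "body_integral f (\<lambda>\<xi>. (\<xi> \<bullet> u) * (\<xi> \<bullet> u)) \<le>
      (LINT \<xi>|lborel. indicator (polar_body f) \<xi> * (C\<^sup>2 * (norm u)\<^sup>2))"
      unfolding body_integral_def
    proof (intro integral_mono body_integrable f continuous_intros)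
      fix \<xi> :: 'e
      have "(\<xi> \<bullet> u) * (\<xi> \<bullet> u) \<le> C\<^sup>2 * (norm u)\<^sup>2" if "\<xi> \<in> polar_body f"
      proof -
        have "norm \<xi> \<le> C" using polar_body_subset_cball[of f C] C that by auto
        then have "\<bar>\<xi> \<bullet> u\<bar> \<le> C * norm u"
          by (intro order_trans[OF Cauchy_Schwarz_ineq2] mult_right_mono) auto
        then have "\<bar>\<xi> \<bullet> u\<bar>\<^sup>2 \<le> (C * norm u)\<^sup>2" by (intro power_mono) auto
        then show ?thesis by (simp add: power2_eq_square algebra_simps)
      qed
      then show "indicator (polar_body f) \<xi> * ((\<xi> \<bullet> u) * (\<xi> \<bullet> u)) \<le> indicator (polar_body f) \<xi> * (C\<^sup>2 * (norm u)\<^sup>2)"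
        by (auto simp: indicator_def)
    qed
    also have "\<dots> = C\<^sup>2 * (norm u)\<^sup>2 * body_integral f (\<lambda>_. 1)" by (simp add: body_integral_def)
    finally show ?thesis using body_volume_pos[OF f] by (simp add: body_form_def divide_simps)
  qed
  then show ?thesis using that[of "C\<^sup>2"] by simp
qed

lemma gauge_like_compose:
  fixes A A' :: "'e::euclidean_space \<Rightarrow> 'e"
  assumes f: "gauge_like f" and lin: "linear A" "linear A'" and inv: "\<And>x. A' (A x) = x"
  shows "gauge_like (\<lambda>y. f (A y))"
proof -
  obtain c C where c: "c > 0" "\<And>y. c * norm y \<le> f y" and C: "\<And>y. f y \<le> C * norm y"
    using f by (auto simp: gauge_like_def)
  obtain k where k: "k > 0" "\<And>x. norm (A x) \<le> k * norm x"
    using lin(1) by (metis linear_bounded_pos)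
  obtain l where l: "l > 0" "\<And>x. norm (A' x) \<le> l * norm x"
    using lin(2) by (metis linear_bounded_pos)
  have "c / l * norm y \<le> f (A y)" for y
  proof -
    have "norm y \<le> l * norm (A y)" using l(2)[of "A y"] inv by simp
    then have "c / l * norm y \<le> c / l * (l * norm (A y))" using c l by (intro mult_left_mono) auto
    also have "\<dots> = c * norm (A y)" using l by simp
    finally show ?thesis using c(2)[of "A y"] by simp
  qed
  moreover have "f (A y) \<le> (max C 0 * k) * norm y" for y
  proof -
    have "f (A y) \<le> max C 0 * norm (A y)" using C[of "A y"]
      by (meson max.cobounded1 mult_right_mono norm_ge_zero order_trans)
    also have "\<dots> \<le> max C 0 * (k * norm y)" using k by (intro mult_left_mono) auto
    finally show ?thesis by simp
  qed
  ultimately show ?thesis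
    using f lin c l unfolding gauge_like_def
    by (intro conjI exI[of _ "c / l"] exI[of _ "max C 0 * k"] allI impI) (auto simp: linear_scale)
qed

text \<open>The adjoint of the inverse of \<open>A\<close> maps the polar body of \<open>f \<circ> A\<close> onto the one of \<open>f\<close> and moves \<open>A\<close> to the
arguments \<open>u\<close>, \<open>v\<close>. The unknown factor of the change of variables cancels in the quotient.\<close>

lemma body_form_compose:
  fixes A A' :: "'e::euclidean_space \<Rightarrow> 'e"
  assumes lin: "linear A" "linear A'" and inv: "\<And>x. A' (A x) = x" "\<And>x. A (A' x) = x"
    and f: "gauge_like f"
  shows "body_form (\<lambda>y. f (A y)) u v = body_form f (A u) (A v)"
proof -
  let ?T = "adjoint A'"
  have linT: "linear ?T" "linear (adjoint A)" using lin by (auto simp: adjoint_linear)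
  have invT: "?T (adjoint A x) = x" "adjoint A (?T x) = x" for x
  proof -
    have "y \<bullet> ?T (adjoint A x) = y \<bullet> x" "y \<bullet> adjoint A (?T x) = y \<bullet> x" for y
      by (simp_all only: adjoint_works[OF lin(1)] adjoint_works[OF lin(2)] inv)
    then show "?T (adjoint A x) = x" "adjoint A (?T x) = x"
      by (metis vector_eq_ldot)+
  qed
  obtain c where c: "c > 0" and int: "\<And>q :: 'e \<Rightarrow> real. q \<in> borel_measurable borel \<Longrightarrow>
       (LINT x|lborel. q (?T x)) = c * (LINT x|lborel. q x)"
    by (rule lborel_integral_linear_bijection[OF linT invT]) blast
  have T: "?T \<xi> \<bullet> y = \<xi> \<bullet> A' y" for \<xi> y
    using adjoint_works[OF lin(2), of y \<xi>] by (simp add: inner_commute)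
  have mem: "\<xi> \<in> polar_body (\<lambda>y. f (A y)) \<longleftrightarrow> ?T \<xi> \<in> polar_body f" for \<xi>
    unfolding polar_body_def by (auto simp: T) (metis inv)+
  have ind: "indicator (polar_body (\<lambda>y. f (A y))) \<xi> = (indicator (polar_body f) (?T \<xi>) :: real)" for \<xi>
    by (simp add: indicator_def mem)
  have [measurable]: "polar_body f \<in> sets borel" by (simp add: closed_polar_body)
  have "body_integral (\<lambda>y. f (A y)) (\<lambda>\<xi>. (\<xi> \<bullet> u) * (\<xi> \<bullet> v)) =
     c * body_integral f (\<lambda>\<xi>. (\<xi> \<bullet> A u) * (\<xi> \<bullet> A v))"
    unfolding body_integral_def using int[of "\<lambda>\<xi>. indicator (polar_body f) \<xi> * ((\<xi> \<bullet> A u) * (\<xi> \<bullet> A v))"]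
    by (simp add: ind T inv)
  moreover have "body_integral (\<lambda>y. f (A y)) (\<lambda>\<xi>. 1) = c * body_integral f (\<lambda>\<xi>. 1)"
    unfolding body_integral_def using int[of "\<lambda>\<xi>. indicator (polar_body f) \<xi> * 1"]
    by (simp add: ind T inv)
  ultimately show ?thesis using c by (simp add: body_form_def)
qed

text \<open>For homotheties the factor must be explicit, because \<open>body_form_perturb\<close> compares a numerator and a
denominator that are taken at different scales.\<close>

lemma body_integral_scale:
  fixes f :: "'e::euclidean_space \<Rightarrow> real"
  assumes f: "gauge_like f" and r: "r > 0" and q: "q \<in> borel_measurable borel"
  shows "body_integral (\<lambda>y. r * f y) q = r ^ DIM('e) * body_integral f (\<lambda>\<xi>. q (r *\<^sub>R \<xi>))"
proof -
  have [measurable]: "polar_body (\<lambda>y. r * f y) \<in> sets borel" "q \<in> borel_measurable borel"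
    using q by (simp_all add: closed_polar_body)
  have eq: "lborel = density (distr lborel borel (\<lambda>x::'e. 0 + r *\<^sub>R x)) (\<lambda>_. \<bar>r\<bar>^DIM('e))"
    by (rule lborel_affine) (use r in simp)
  have mem: "r *\<^sub>R \<xi> \<in> polar_body (\<lambda>y. r * f y) \<longleftrightarrow> \<xi> \<in> polar_body f" for \<xi>
    using r by (simp add: polar_body_def)
  have "body_integral (\<lambda>y. r * f y) q =
      (LINT \<xi>|density (distr lborel borel (\<lambda>x::'e. 0 + r *\<^sub>R x)) (\<lambda>_. \<bar>r\<bar>^DIM('e)).
         indicator (polar_body (\<lambda>y. r * f y)) \<xi> * q \<xi>)"
    unfolding body_integral_def using eq by simp
  also have "\<dots> = r ^ DIM('e) * (LINT \<xi>|distr lborel borel (\<lambda>x::'e. r *\<^sub>R x).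
         indicator (polar_body (\<lambda>y. r * f y)) \<xi> * q \<xi>)"
    using r by (subst integral_density) (auto simp: ennreal_power[symmetric])
  also have "\<dots> = r ^ DIM('e) * body_integral f (\<lambda>\<xi>. q (r *\<^sub>R \<xi>))"
    unfolding body_integral_def using r
    by (subst integral_distr) (auto simp: indicator_def mem)
  finally show ?thesis .
qed

lemma gauge_like_scale: "gauge_like f \<Longrightarrow> r > 0 \<Longrightarrow> gauge_like (\<lambda>y. r * f y)"
  unfolding gauge_like_def
proof (elim conjE exE, intro conjI)
  fix c C assume r: "r > 0" and "c > 0" "\<forall>y. c * norm y \<le> f y" "\<forall>y. f y \<le> C * norm y"
  then show "\<exists>c>0. \<forall>y. c * norm y \<le> r * f y"
    by (intro exI[of _ "r * c"]) (auto simp: mult.assoc)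
  show "\<exists>C. \<forall>y. r * f y \<le> C * norm y"
    using r \<open>\<forall>y. f y \<le> C * norm y\<close> by (intro exI[of _ "r * C"]) (auto simp: mult.assoc)
qed auto

text \<open>On the unit interval a convex function lies below its chord.\<close>

lemma power_one_plus_le: "0 \<le> x \<Longrightarrow> x \<le> 1 \<Longrightarrow> (1 + x) ^ m \<le> 1 + x * (2 ^ m - 1)" for x :: real
proof (induction m)
  case (Suc m)
  have "(1 + x) ^ Suc m \<le> (1 + x) * (1 + x * (2 ^ m - 1))"
    using Suc by (simp add: mult_left_mono)
  also have "\<dots> \<le> 1 + x * (2 ^ Suc m - 1)"
    using Suc.prems mult_right_mono[of "x * x" x "2 ^ m - 1"] mult_left_mono[of x 1 x]
    by (simp add: algebra_simps)
  finally show ?case .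
qed simp

text \<open>The polar body of \<open>g\<close> lies between the homothetic images of that of \<open>f\<close> with factors \<open>1 - e\<close> and
\<open>1 + e\<close>. In dimension \<open>n\<close> the second moment scales with the power \<open>n + 2\<close> and the volume with the power
\<open>n\<close>, so the quotient of the two forms lies between \<open>(1 - e)\<^sup>n\<^sup>+\<^sup>2 / (1 + e)\<^sup>n\<close> and
\<open>(1 + e)\<^sup>n\<^sup>+\<^sup>2 / (1 - e)\<^sup>n\<close>. The constant is crude; what matters is that the bound is linear in \<open>e\<close>.\<close>

lemma body_form_perturb:
  fixes f g :: "'e::euclidean_space \<Rightarrow> real"
  assumes f: "gauge_like f" and g: "gauge_like g"
    and e: "0 \<le> e" "e \<le> 1/2" and fg: "\<And>y. \<bar>g y - f y\<bar> \<le> e * f y"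
  shows "\<bar>body_form g u u - body_form f u u\<bar> \<le> 2 * 2 ^ (2 * DIM('e) + 2) * e * body_form f u u"
proof -
  let ?n = "DIM('e)"
  let ?q = "\<lambda>\<xi>. (\<xi> \<bullet> u) * (\<xi> \<bullet> u)"
  define J where "J f = body_integral f ?q" for f
  define V where "V f = body_integral f (\<lambda>_. 1)" for f :: "'e \<Rightarrow> real"
  have sc: "J (\<lambda>y. r * f y) = r ^ (?n + 2) * J f" "V (\<lambda>y. r * f y) = r ^ ?n * V f" if "r > 0" for r
    using that unfolding J_def V_def
    by (subst body_integral_scale[OF f that]; simp add: body_integral_def power_add power2_eq_square algebra_simps)+
  have hi: "gauge_like (\<lambda>y. (1 + e) * f y)" and lo: "gauge_like (\<lambda>y. (1 - e) * f y)"
    using e by (auto intro!: gauge_like_scale f)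
  have le: "g y \<le> (1 + e) * f y" "(1 - e) * f y \<le> g y" for y
    using fg[of y] by (auto simp: algebra_simps abs_le_iff)
  have J1: "J g \<le> (1 + e) ^ (?n + 2) * J f"
    using body_integral_mono[OF g hi le(1), of ?q] e sc[of "1 + e"] by (simp add: J_def continuous_on_mult continuous_on_inner)
  have J2: "(1 - e) ^ (?n + 2) * J f \<le> J g"
    using body_integral_mono[OF lo g le(2), of ?q] e sc[of "1 - e"] by (simp add: J_def continuous_on_mult continuous_on_inner)
  have V1: "V g \<le> (1 + e) ^ ?n * V f"
    using body_integral_mono[OF g hi le(1), of "\<lambda>_. 1"] e sc[of "1 + e"] by (simp add: V_def)
  have V2: "(1 - e) ^ ?n * V f \<le> V g"
    using body_integral_mono[OF lo g le(2), of "\<lambda>_. 1"] e sc[of "1 - e"] by (simp add: V_def)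
  have Vp: "V f > 0" "V g > 0" using f g by (auto simp: V_def body_volume_pos)
  have Jp: "J f \<ge> 0" "J g \<ge> 0" unfolding J_def body_integral_def by (auto intro!: integral_nonneg_AE)
  have Q: "body_form f u u = J f / V f" "body_form g u u = J g / V g"
    by (auto simp: body_form_def J_def V_def)
  have ee: "e * e \<le> e * (1 / 2)" using e by (intro mult_left_mono) auto
  have e1: "1 / (1 - e) \<le> 1 + 2 * e" using e ee by (simp add: field_simps)
  have e2: "1 - e \<le> 1 / (1 + e)" using e by (simp add: field_simps)
  let ?C = "2 ^ (2 * ?n + 2) :: real"
  have pow: "x ^ (?n + 2) * x ^ ?n = x ^ (2 * ?n + 2)" for x :: real
  proof -
    have "?n + 2 + ?n = 2 * ?n + 2" by simp
    then show ?thesis by (metis power_add)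
  qed
  have "J g / V g \<le> ((1 + e) ^ (?n + 2) * J f) / ((1 - e) ^ ?n * V f)"
    using J1 V2 Vp Jp e by (intro frac_le) auto
  also have "\<dots> = ((1 + e) ^ (?n + 2) * (1 / (1 - e)) ^ ?n) * (J f / V f)"
    by (simp add: power_divide)
  also have "\<dots> \<le> ((1 + 2 * e) ^ (?n + 2) * (1 + 2 * e) ^ ?n) * (J f / V f)"
    using e e1 Jp Vp by (intro mult_right_mono mult_mono power_mono) auto
  also have "\<dots> = (1 + 2 * e) ^ (2 * ?n + 2) * (J f / V f)"
    by (simp only: pow)
  also have "\<dots> \<le> (1 + 2 * e * (?C - 1)) * (J f / V f)"
    using e Jp Vp by (intro mult_right_mono power_one_plus_le) auto
  also have "\<dots> \<le> (1 + 2 * e * ?C) * (J f / V f)"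
    using e Jp Vp by (intro mult_right_mono add_left_mono mult_left_mono) auto
  finally have upper: "J g / V g \<le> (1 + 2 * e * ?C) * (J f / V f)" .
  have n2: "real (2 * ?n + 2) \<le> ?C"
    using of_nat_less_two_power[of "2 * ?n + 2", where ?'a = real] by linarith
  have "real (2 * ?n + 2) * e \<le> ?C * (2 * e)"
    using e n2 by (intro mult_mono) auto
  then have "(1 - 2 * e * ?C) * (J f / V f) \<le> (1 + real (2 * ?n + 2) * - e) * (J f / V f)"
    using Jp Vp by (intro mult_right_mono) (auto simp: mult.commute)
  also have "\<dots> \<le> (1 + - e) ^ (2 * ?n + 2) * (J f / V f)"
    using e Jp Vp by (intro mult_right_mono Bernoulli_inequality) auto
  also have "\<dots> = ((1 - e) ^ (?n + 2) * (1 - e) ^ ?n) * (J f / V f)"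
    by (simp only: pow add_uminus_conv_diff)
  also have "\<dots> \<le> ((1 - e) ^ (?n + 2) * (1 / (1 + e)) ^ ?n) * (J f / V f)"
    using e e2 Jp Vp by (intro mult_right_mono mult_left_mono power_mono) auto
  also have "\<dots> = ((1 - e) ^ (?n + 2) * J f) / ((1 + e) ^ ?n * V f)"
    by (simp add: power_divide)
  also have "\<dots> \<le> J g / V g"
    using J2 V1 Vp Jp e by (intro frac_le) auto
  finally have lower: "(1 - 2 * e * ?C) * (J f / V f) \<le> J g / V g" .
  show ?thesis using upper lower unfolding Q by (auto simp: abs_le_iff algebra_simps)
qed

section \<open>First variation of the covariance form\<close>

text \<open>The two constants are the extreme values on the unit sphere.\<close>

lemma gauge_like_continuous:
  fixes f :: "'e::euclidean_space \<Rightarrow> real"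
  assumes hom: "\<And>r y. 0 \<le> r \<Longrightarrow> f (r *\<^sub>R y) = r * f y"
    and pos: "\<And>y. y \<noteq> 0 \<Longrightarrow> f y > 0"
    and cont: "continuous_on (- {0}) f"
  shows "gauge_like f"
proof -
  have c: "continuous_on (sphere 0 1) f" using cont by (rule continuous_on_subset) auto
  have ne: "sphere (0::'e) 1 \<noteq> {}" by simp
  obtain a where a: "a \<in> sphere 0 1" "\<And>y. y \<in> sphere 0 1 \<Longrightarrow> f a \<le> f y"
    using continuous_attains_inf[OF compact_sphere ne c] by blast
  obtain b where b: "b \<in> sphere 0 1" "\<And>y. y \<in> sphere 0 1 \<Longrightarrow> f y \<le> f b"
    using continuous_attains_sup[OF compact_sphere ne c] by blast
  have "f a * norm y \<le> f y \<and> f y \<le> f b * norm y" for y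
  proof (cases "y = 0")
    case True then show ?thesis using hom[of 0 y] by simp
  next
    case False
    then have "f y = norm y * f (y /\<^sub>R norm y)" using hom[of "norm y" "y /\<^sub>R norm y"] by simp
    moreover have "y /\<^sub>R norm y \<in> sphere 0 1" using False by simp
    ultimately show ?thesis using a(2) b(2)
      by (metis mult.commute mult_left_mono norm_ge_zero)
  qed
  moreover have "f a > 0" using a(1) by (intro pos) auto
  ultimately show ?thesis unfolding gauge_like_def using hom by blast
qed

text \<open>The points \<open>(x0 + \<xi>, y)\<close> and \<open>(x0, y + G \<xi> y)\<close> are joined by a segment with velocity \<open>(\<xi>, - G \<xi> y)\<close>. The
derivative of \<open>L\<close> in this direction vanishes at \<open>(x0, y)\<close>; it is small, uniformly for \<open>y\<close> in the unit
sphere, at nearby points since it is uniformly continuous on compact sets. The mean value theorem and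
homogeneity in \<open>y\<close> give the estimate.\<close>

lemma transported_gauge_estimate:
  fixes L :: "'x::euclidean_space \<times> 'e::euclidean_space \<Rightarrow> real" and G :: "'x \<Rightarrow> 'e \<Rightarrow> 'e"
  assumes U: "open U" "x0 \<in> U"
    and diff: "\<And>x y. x \<in> U \<Longrightarrow> y \<noteq> 0 \<Longrightarrow> L differentiable (at (x, y))"
    and cont: "\<And>v. continuous_on (U \<times> (UNIV - {0})) (\<lambda>z. frechet_derivative L (at z) v)"
    and hom: "\<And>x r y. x \<in> U \<Longrightarrow> 0 \<le> r \<Longrightarrow> L (x, r *\<^sub>R y) = r * L (x, y)"
    and G: "bounded_bilinear G"
    and horizontal: "\<And>\<xi> y. y \<noteq> 0 \<Longrightarrow>
      frechet_derivative L (at (x0, y)) (\<xi>, 0) = frechet_derivative L (at (x0, y)) (0, G \<xi> y)"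
    and e: "e > 0"
  obtains d where "d > 0" "\<And>\<xi>. norm \<xi> < d \<Longrightarrow> x0 + \<xi> \<in> U"
    "\<And>\<xi> y. norm \<xi> < d \<Longrightarrow> \<bar>L (x0 + \<xi>, y) - L (x0, y + G \<xi> y)\<bar> \<le> e * norm \<xi> * norm y"
proof -
  interpret G: bounded_bilinear G by fact
  obtain r where r: "r > 0" "cball x0 r \<subseteq> U" using U open_contains_cball by blast
  obtain B where B: "B > 0" "\<And>\<xi> y. norm (G \<xi> y) \<le> norm \<xi> * norm y * B" using G.pos_bounded by blast
  \<comment> \<open>shells of radii \<open>1/2\<close> and \<open>3/2\<close> leave room for \<open>y + (1 - t) G \<xi> y\<close> with \<open>y\<close> a unit vector\<close>
  define S where "S = cball x0 r \<times> (cball (0::'e) (3/2) - ball 0 (1/2))"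
  have compS: "compact S" unfolding S_def by (intro compact_Times compact_diff) auto
  have SU: "S \<subseteq> U \<times> (UNIV - {0})" using r by (auto simp: S_def)
  \<comment> \<open>the derivative of \<open>L\<close> along \<open>(\<eta>, - G \<eta> y)\<close>, expanded in a basis so that it is jointly continuous\<close>
  define E where "E p = (\<Sum>b\<in>Basis. ((fst (snd p), - G (fst (snd p)) (snd (snd p))) \<bullet> b) *
      frechet_derivative L (at (fst p)) b)" for p :: "('x \<times> 'e) \<times> 'x \<times> 'e"
  have E_eq: "E (z, \<eta>, y) = frechet_derivative L (at z) (\<eta>, - G \<eta> y)" if "z \<in> S" for z \<eta> y
  proof -
    have lin: "linear (frechet_derivative L (at z))"
      using SU that diff by (cases z) (auto intro!: linear_frechet_derivative)
    have "frechet_derivative L (at z) (\<eta>, - G \<eta> y) =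
        frechet_derivative L (at z) (\<Sum>b\<in>Basis. ((\<eta>, - G \<eta> y) \<bullet> b) *\<^sub>R b)"
      by (simp only: euclidean_representation)
    also have "\<dots> = E (z, \<eta>, y)"
      unfolding E_def by (simp only: linear_sum[OF lin] linear_scale[OF lin] fst_conv snd_conv real_scaleR_def)
    finally show ?thesis by simp
  qed
  let ?K = "S \<times> cball (0::'x) 1 \<times> cball (0::'e) 1"
  have "continuous_on ?K E"
    unfolding E_def
  proof (intro continuous_on_sum continuous_on_mult continuous_intros G.continuous_on)
    fix b :: "'x \<times> 'e"
    show "continuous_on ?K (\<lambda>p. frechet_derivative L (at (fst p)) b)"
      by (rule continuous_on_compose2[OF cont]) (use SU in \<open>auto intro!: continuous_intros\<close>)
  qed
  then have "uniformly_continuous_on ?K E"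
    by (intro compact_uniformly_continuous compact_Times compS) auto
  then obtain d1 where d1: "d1 > 0"
    "\<And>p p'. p \<in> ?K \<Longrightarrow> p' \<in> ?K \<Longrightarrow> dist p' p < d1 \<Longrightarrow> dist (E p') (E p) < e"
    unfolding uniformly_continuous_on_def using e by blast
  define d where "d = min r (min (1 / (2 * B)) (d1 / (1 + B)))"
  have d: "d > 0" using r B d1 by (simp add: d_def)
  have unit: "\<bar>L (x0 + \<xi>, y) - L (x0, y + G \<xi> y)\<bar> \<le> e * norm \<xi>"
    if \<xi>: "norm \<xi> < d" and y: "norm y = 1" for \<xi> y
  proof (cases "\<xi> = 0")
    case True then show ?thesis by (simp add: G.zero_left)
  next
    case False
    define p where "p t = (x0 + t *\<^sub>R \<xi>, y + (1 - t) *\<^sub>R G \<xi> y)" for t :: real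
    have Gn: "norm (G \<xi> y) \<le> norm \<xi> * B" using B(2)[of \<xi> y] y by simp
    have "norm \<xi> * B \<le> 1 / (2 * B) * B" using \<xi> B by (intro mult_right_mono) (auto simp: d_def)
    then have Gh: "norm (G \<xi> y) \<le> 1 / 2" using Gn B by simp
    have pS: "p t \<in> S" if t: "0 \<le> t" "t \<le> 1" for t
    proof -
      have "norm (t *\<^sub>R \<xi>) \<le> r" using t \<xi> mult_right_mono[of t 1 "norm \<xi>"] by (auto simp: d_def)
      moreover have n: "norm ((1 - t) *\<^sub>R G \<xi> y) \<le> 1 / 2"
        using t Gh mult_right_mono[of "1 - t" 1 "norm (G \<xi> y)"] by auto
      moreover have "norm (y + (1 - t) *\<^sub>R G \<xi> y) \<le> 3 / 2"
        using n y norm_triangle_ineq[of y "(1 - t) *\<^sub>R G \<xi> y"] by linarith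
      moreover have "1 / 2 \<le> norm (y + (1 - t) *\<^sub>R G \<xi> y)"
        using n y norm_diff_ineq[of y "(1 - t) *\<^sub>R G \<xi> y"] by linarith
      ultimately show ?thesis by (auto simp: S_def p_def dist_norm[of x0] simp flip: norm_conv_dist)
    qed
    have der: "((\<lambda>t. L (p t)) has_derivative
        (\<lambda>h. frechet_derivative L (at (p t)) (h *\<^sub>R \<xi>, - (h *\<^sub>R G \<xi> y)))) (at t within {0..1})"
      if t: "0 \<le> t" "t \<le> 1" for t
    proof -
      have "L differentiable (at (p t))" using pS[OF t] SU diff by (cases "p t") auto
      then have "(L has_derivative frechet_derivative L (at (p t))) (at (p t))"
        by (simp add: frechet_derivative_works)
      moreover have "(p has_derivative (\<lambda>h. (h *\<^sub>R \<xi>, - (h *\<^sub>R G \<xi> y)))) (at t within {0..1})"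
        unfolding p_def by (auto intro!: derivative_eq_intros simp: algebra_simps)
      ultimately show ?thesis by (rule has_derivative_compose[rotated])
    qed
    obtain \<tau> where \<tau>: "0 < \<tau>" "\<tau> < 1"
      "L (p 1) - L (p 0) = frechet_derivative L (at (p \<tau>)) ((1 - 0) *\<^sub>R \<xi>, - ((1 - 0) *\<^sub>R G \<xi> y))"
      using mvt_simple[OF zero_less_one der] by auto
    have \<tau>S: "p \<tau> \<in> S" using pS \<tau> by auto
    have lin: "linear (frechet_derivative L (at (p \<tau>)))"
      using \<tau>S SU diff by (cases "p \<tau>") (auto intro!: linear_frechet_derivative)
    let ?\<eta> = "\<xi> /\<^sub>R norm \<xi>"
    have "(\<xi>, - G \<xi> y) = norm \<xi> *\<^sub>R (?\<eta>, - G ?\<eta> y)"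
      using False by (simp add: G.scaleR_left)
    then have val: "L (p 1) - L (p 0) = norm \<xi> * E (p \<tau>, ?\<eta>, y)"
      using \<tau>(3) by (simp only: E_eq[OF \<tau>S] linear_scale[OF lin, symmetric] real_scaleR_def[symmetric]) simp
    have y0: "(x0, y) \<in> S" using y r by (auto simp: S_def)
    have zero: "E ((x0, y), ?\<eta>, y) = 0"
    proof -
      have l0: "linear (frechet_derivative L (at (x0, y)))"
        using y U by (intro linear_frechet_derivative diff) auto
      have "(?\<eta>, - G ?\<eta> y) = (?\<eta>, 0) - (0, G ?\<eta> y)" by simp
      then show ?thesis
        unfolding E_eq[OF y0] using horizontal[of y ?\<eta>] y by (metis linear_diff[OF l0] diff_self norm_zero zero_neq_one)
    qed
    have "dist (p \<tau>, ?\<eta>, y) ((x0, y), ?\<eta>, y) = norm (\<tau> *\<^sub>R \<xi>, (1 - \<tau>) *\<^sub>R G \<xi> y)"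
      by (simp add: dist_Pair_Pair p_def dist_norm norm_Pair)
    also have "\<dots> \<le> norm (\<tau> *\<^sub>R \<xi>) + norm ((1 - \<tau>) *\<^sub>R G \<xi> y)" by (rule norm_Pair_le)
    also have "\<dots> \<le> norm \<xi> + norm \<xi> * B"
      using \<tau> Gn mult_right_mono[of \<tau> 1 "norm \<xi>"] mult_right_mono[of "1 - \<tau>" 1 "norm (G \<xi> y)"]
      by (intro add_mono) auto
    also have "\<dots> < d1"
    proof -
      have "norm \<xi> < d1 / (1 + B)" using \<xi> by (simp add: d_def)
      then show ?thesis using B by (simp add: field_simps)
    qed
    finally have "dist (E (p \<tau>, ?\<eta>, y)) (E ((x0, y), ?\<eta>, y)) < e"
      by (intro d1(2)) (use \<tau>S y0 y False in auto)
    then have "\<bar>E (p \<tau>, ?\<eta>, y)\<bar> < e" using zero by simp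
    then have "\<bar>L (p 1) - L (p 0)\<bar> \<le> norm \<xi> * e" unfolding val abs_mult
      by (intro mult_mono) auto
    then show ?thesis by (simp add: p_def mult.commute)
  qed
  show ?thesis
  proof (rule that[OF d])
    show inU: "x0 + \<xi> \<in> U" if "norm \<xi> < d" for \<xi>
      using that r by (auto simp: d_def dist_norm subset_iff)
    show "\<bar>L (x0 + \<xi>, y) - L (x0, y + G \<xi> y)\<bar> \<le> e * norm \<xi> * norm y" if \<xi>: "norm \<xi> < d" for \<xi> y
    proof (cases "y = 0")
      case True
      then show ?thesis using hom[OF inU[OF \<xi>], of 0 y] hom[OF U(2), of 0 y] by (simp add: G.zero_right)
    next
      case False
      let ?u = "y /\<^sub>R norm y"
      have "L (x0 + \<xi>, y) = norm y * L (x0 + \<xi>, ?u)"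
        using hom[OF inU[OF \<xi>], of "norm y" ?u] False by simp
      moreover have "y + G \<xi> y = norm y *\<^sub>R (?u + G \<xi> ?u)"
        using False by (simp add: G.scaleR_right scaleR_add_right)
      then have "L (x0, y + G \<xi> y) = norm y * L (x0, ?u + G \<xi> ?u)"
        using hom[OF U(2), of "norm y"] by simp
      moreover have "norm y * \<bar>L (x0 + \<xi>, ?u) - L (x0, ?u + G \<xi> ?u)\<bar> \<le> norm y * (e * norm \<xi>)"
        by (intro mult_left_mono unit \<xi>) (use False in auto)
      ultimately show ?thesis by (simp add: right_diff_distrib[symmetric] abs_mult mult.commute)
    qed
  qed
qed

text \<open>With \<open>R = I + G \<xi>\<close> and \<open>M\<close> the form at \<open>x0\<close>, the form of \<open>y \<mapsto> L(x0, R y)\<close> at \<open>u\<close> is \<open>M(R u, R u)\<close>, which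
expands to \<open>M(u, u) + 2 M(u, G \<xi> u) + M(G \<xi> u, G \<xi> u)\<close>. Replacing \<open>L(x0, R y)\<close> by \<open>L(x0 + \<xi>, y)\<close> changes it
by \<open>o(\<xi>)\<close>, because the two functions have ratio \<open>1 + o(\<xi>)\<close> uniformly in \<open>y\<close>.\<close>

lemma body_form_has_derivative:
  fixes L :: "'x::euclidean_space \<times> 'e::euclidean_space \<Rightarrow> real" and G :: "'x \<Rightarrow> 'e \<Rightarrow> 'e"
  assumes U: "open U" "x0 \<in> U"
    and diff: "\<And>x y. x \<in> U \<Longrightarrow> y \<noteq> 0 \<Longrightarrow> L differentiable (at (x, y))"
    and cont: "\<And>v. continuous_on (U \<times> (UNIV - {0})) (\<lambda>z. frechet_derivative L (at z) v)"
    and hom: "\<And>x r y. x \<in> U \<Longrightarrow> 0 \<le> r \<Longrightarrow> L (x, r *\<^sub>R y) = r * L (x, y)"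
    and gauge: "\<And>x. x \<in> U \<Longrightarrow> gauge_like (\<lambda>y. L (x, y))"
    and G: "bounded_bilinear G"
    and horizontal: "\<And>\<xi> y. y \<noteq> 0 \<Longrightarrow>
      frechet_derivative L (at (x0, y)) (\<xi>, 0) = frechet_derivative L (at (x0, y)) (0, G \<xi> y)"
  shows "((\<lambda>x. body_form (\<lambda>y. L (x, y)) u u) has_derivative
     (\<lambda>\<xi>. 2 * body_form (\<lambda>y. L (x0, y)) u (G \<xi> u))) (at x0)"
proof -
  interpret G: bounded_bilinear G by fact
  define M where "M = body_form (\<lambda>y. L (x0, y))"
  have gauge0: "gauge_like (\<lambda>y. L (x0, y))" using gauge U by blast
  have Mlin: "M (a *\<^sub>R p + b *\<^sub>R q) w = a * M p w + b * M q w" for a b p q w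
    unfolding M_def by (rule body_form_linear[OF gauge0])
  have Msym: "M p q = M q p" for p q unfolding M_def by (rule body_form_sym)
  have Madd: "M (p + q) w = M p w + M q w" for p q w using Mlin[of 1 p 1 q w] by simp
  have Msc: "M (a *\<^sub>R p) w = a * M p w" for a p w using Mlin[of a p 0 p w] by simp
  have Mexp: "M (p + q) (p + q) = M p p + 2 * M p q + M q q" for p q
    using Madd[of p q "p + q"] Madd[of p q p] Madd[of p q q] Msym[of p "p + q"] Msym[of q "p + q"] Msym[of q p]
    by linarith
  have linM: "linear (\<lambda>\<xi>. 2 * M u (G \<xi> u))"
    by (rule linearI) (simp_all only: G.add_left G.scaleR_left Msym[of u] Madd Msc real_scaleR_def, simp_all)
  obtain N where N: "N \<ge> 0" "\<And>u. M u u \<le> N * (norm u)\<^sup>2"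
    using body_form_upper[OF gauge0] unfolding M_def by blast
  obtain m where m: "m > 0" "\<And>y. m * norm y \<le> L (x0, y)" using gauge0 by (auto simp: gauge_like_def)
  obtain B where B: "B > 0" "\<And>\<xi> y. norm (G \<xi> y) \<le> norm \<xi> * norm y * B" using G.pos_bounded by blast
  define C :: real where "C = 2 * 2 ^ (2 * DIM('e) + 2)"
  have C: "C > 0" by (simp add: C_def)
  show ?thesis
    unfolding has_derivative_at_alt M_def[symmetric]
  proof (intro conjI allI impI)
    show "bounded_linear (\<lambda>\<xi>. 2 * M u (G \<xi> u))" using linM by (simp add: linear_conv_bounded_linear)
    fix e :: real assume e: "e > 0"
    \<comment> \<open>the constants are chosen so that the two error terms are at most \<open>e/2 * norm \<xi>\<close> each\<close>
    define k where "k = C * (2 / m) * (N * (9 / 4 * (norm u)\<^sup>2))"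
    have k: "k \<ge> 0" using C m N by (simp add: k_def)
    define \<epsilon> where "\<epsilon> = e / (2 * (k + 1))"
    have \<epsilon>: "\<epsilon> > 0" "k * \<epsilon> \<le> e / 2" using e k by (auto simp: \<epsilon>_def field_simps)
    obtain d where d: "d > 0" "\<And>\<xi>. norm \<xi> < d \<Longrightarrow> x0 + \<xi> \<in> U"
      "\<And>\<xi> y. norm \<xi> < d \<Longrightarrow> \<bar>L (x0 + \<xi>, y) - L (x0, y + G \<xi> y)\<bar> \<le> \<epsilon> * norm \<xi> * norm y"
      using transported_gauge_estimate[OF U diff cont hom G horizontal \<epsilon>(1)] by blast
    define k2 where "k2 = N * (B * norm u)\<^sup>2"
    have k2: "k2 \<ge> 0" using N by (simp add: k2_def)
    \<comment> \<open>besides \<open>d\<close>, the bounds make \<open>R\<close> injective, make \<open>\<delta> \<le> 1/2\<close>, and control the quadratic term, in this order\<close>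
    define d' where "d' = min d (min (1 / (2 * B)) (min (m / (4 * \<epsilon>)) (e / (2 * (k2 + 1)))))"
    have "d' > 0" using d B m \<epsilon> e k2 by (simp add: d'_def)
    moreover have "norm (body_form (\<lambda>y. L (x, y)) u u - M u u - 2 * M u (G (x - x0) u)) \<le> e * norm (x - x0)"
      if x: "norm (x - x0) < d'" for x
    proof -
      define \<xi> where "\<xi> = x - x0"
      have \<xi>: "norm \<xi> < d" "norm \<xi> < 1 / (2 * B)" "norm \<xi> < m / (4 * \<epsilon>)" "norm \<xi> < e / (2 * (k2 + 1))"
        using x by (auto simp: \<xi>_def d'_def)
      define R where "R y = y + G \<xi> y" for y
      have linR: "linear R" unfolding R_def
        by (rule linearI) (simp_all add: G.add_right G.scaleR_right algebra_simps)
      have Gh: "norm (G \<xi> y) \<le> norm y / 2" for y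
      proof -
        have "norm \<xi> * B \<le> 1 / 2" using \<xi>(2) B by (simp add: field_simps)
        then have "norm \<xi> * B * norm y \<le> 1 / 2 * norm y" by (intro mult_right_mono) auto
        then show ?thesis using B(2)[of \<xi> y] by (simp add: mult.commute mult.left_commute)
      qed
      have Rlo: "norm y / 2 \<le> norm (R y)" for y
        using norm_diff_ineq[of y "G \<xi> y"] Gh[of y] unfolding R_def by linarith
      have Rhi: "norm (R y) \<le> 3 / 2 * norm y" for y
        using norm_triangle_ineq[of y "G \<xi> y"] Gh[of y] unfolding R_def by linarith
      have "inj R"
        unfolding linear_injective_0[OF linR] using Rlo by (metis half_gt_zero_iff linorder_not_less norm_eq_zero norm_ge_zero order_antisym_conv zero_less_norm_iff)
      then obtain R' where R': "linear R'" "\<And>x. R' (R x) = x" "\<And>x. R (R' x) = x"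
        using linear_injective_isomorphism[OF linR] by blast
      have gR: "gauge_like (\<lambda>y. L (x0, R y))"
        by (rule gauge_like_compose[OF gauge0 linR R'(1,2)])
      have gx: "gauge_like (\<lambda>y. L (x, y))" using gauge[OF d(2)[OF \<xi>(1)]] by (simp add: \<xi>_def)
      define \<delta> where "\<delta> = \<epsilon> * norm \<xi> * (2 / m)"
      have \<delta>: "0 \<le> \<delta>" "\<delta> \<le> 1 / 2"
        using \<epsilon> m \<xi>(3) by (auto simp: \<delta>_def field_simps)
      have close: "\<bar>L (x, y) - L (x0, R y)\<bar> \<le> \<delta> * L (x0, R y)" for y
      proof -
        have "m * (norm y / 2) \<le> m * norm (R y)" using Rlo m by (intro mult_left_mono) auto
        also have "\<dots> \<le> L (x0, R y)" by (rule m)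
        finally have "norm y \<le> 2 / m * L (x0, R y)" using m by (simp add: field_simps)
        then have "\<epsilon> * norm \<xi> * norm y \<le> \<epsilon> * norm \<xi> * (2 / m * L (x0, R y))"
          using \<epsilon> by (intro mult_left_mono) auto
        then show ?thesis using d(3)[OF \<xi>(1), of y] by (simp add: \<xi>_def R_def \<delta>_def mult.assoc)
      qed
      have Q: "body_form (\<lambda>y. L (x0, R y)) u u = M (R u) (R u)"
        unfolding M_def by (rule body_form_compose[OF linR R'(1,2,3) gauge0])
      have "\<bar>body_form (\<lambda>y. L (x, y)) u u - M (R u) (R u)\<bar> \<le> C * \<delta> * M (R u) (R u)"
        using body_form_perturb[OF gR gx \<delta> close, of u] by (simp add: Q C_def)
      also have "\<dots> \<le> C * \<delta> * (N * (9 / 4 * (norm u)\<^sup>2))"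
      proof (intro mult_left_mono)
        have "(norm (R u))\<^sup>2 \<le> (3 / 2 * norm u)\<^sup>2" using Rhi by (intro power_mono) auto
        then have "(norm (R u))\<^sup>2 \<le> 9 / 4 * (norm u)\<^sup>2" by (simp add: power2_eq_square)
        then show "M (R u) (R u) \<le> N * (9 / 4 * (norm u)\<^sup>2)"
          using N mult_left_mono order_trans by blast
      qed (use C \<delta> in auto)
      also have "\<dots> = k * \<epsilon> * norm \<xi>" by (simp add: k_def \<delta>_def)
      also have "\<dots> \<le> e / 2 * norm \<xi>" using \<epsilon> by (intro mult_right_mono) auto
      finally have 1: "\<bar>body_form (\<lambda>y. L (x, y)) u u - M (R u) (R u)\<bar> \<le> e / 2 * norm \<xi>" .
      have M0: "0 \<le> M (G \<xi> u) (G \<xi> u)"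
        using body_form_pos[OF gauge0, of "G \<xi> u"] Msc[of 0 0 0] unfolding M_def[symmetric]
        by (cases "G \<xi> u = 0") auto
      have "M (G \<xi> u) (G \<xi> u) \<le> N * (norm \<xi> * norm u * B)\<^sup>2"
        using N(2)[of "G \<xi> u"] B(2)[of \<xi> u] N(1)
        by (meson mult_left_mono norm_ge_zero order_trans power_mono)
      also have "\<dots> = k2 * norm \<xi> * norm \<xi>" by (simp add: k2_def power2_eq_square)
      also have "\<dots> \<le> e / 2 * norm \<xi>"
      proof (intro mult_right_mono)
        have "k2 * norm \<xi> \<le> (k2 + 1) * (e / (2 * (k2 + 1)))"
          using \<xi>(4) k2 by (intro mult_mono) auto
        also have "\<dots> = e / 2" using k2 by (simp add: divide_simps)
        finally show "k2 * norm \<xi> \<le> e / 2" .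
      qed simp
      finally have 2: "M (G \<xi> u) (G \<xi> u) \<le> e / 2 * norm \<xi>" .
      have 3: "M (R u) (R u) = M u u + 2 * M u (G \<xi> u) + M (G \<xi> u) (G \<xi> u)"
        unfolding R_def by (rule Mexp)
      have "\<bar>body_form (\<lambda>y. L (x, y)) u u - M u u - 2 * M u (G \<xi> u)\<bar> \<le> e * norm \<xi>"
        using 1 2 M0 unfolding 3 by (simp only: abs_le_iff) linarith
      then show ?thesis by (simp add: \<xi>_def)
    qed
    ultimately show "\<exists>d>0. \<forall>x. norm (x - x0) < d \<longrightarrow>
        norm (body_form (\<lambda>y. L (x, y)) u u - M u u - 2 * M u (G (x - x0) u)) \<le> e * norm (x - x0)"
      by blast
  qed
qed

section \<open>Calculus of continuously differentiable functions\<close>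

lemma Ck_on_Suc_imp: "Ck_on (Suc k) S f \<Longrightarrow> Ck_on k S f"
proof (induction k arbitrary: f)
  case 0
  then show ?case
    by (auto intro!: continuous_at_imp_continuous_on differentiable_imp_continuous_within)
next
  case (Suc k)
  then show ?case by simp
qed

lemma Ck_on_imp_continuous_on: "Ck_on k S f \<Longrightarrow> continuous_on S f"
proof (induction k)
  case (Suc k)
  then show ?case by (blast dest: Ck_on_Suc_imp)
qed simp

text \<open>On an open set the values of a function determine its derivatives, although \<open>frechet_derivative\<close> at a
point refers to the function on the whole space.\<close>

lemma Ck_on_cong:
  assumes "open S" "\<And>x. x \<in> S \<Longrightarrow> f x = g x" "Ck_on k S f"
  shows "Ck_on k S g"
  using assms(2,3)
proof (induction k arbitrary: f g)
  case 0
  then show ?case by (simp cong: continuous_on_cong)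
next
  case (Suc k)
  have der: "(g has_derivative frechet_derivative f (at x)) (at x)" if "x \<in> S" for x
  proof (rule has_derivative_transform_within_open[OF _ assms(1) that])
    show "(f has_derivative frechet_derivative f (at x)) (at x)"
      using Suc.prems that by (auto simp: frechet_derivative_works)
  qed (use Suc.prems in auto)
  show ?case
    unfolding Ck_on.simps
  proof (intro conjI ballI allI)
    fix x assume "x \<in> S" then show "g differentiable (at x)" using der by (auto simp: differentiable_def)
  next
    fix v
    have "Ck_on k S (\<lambda>x. frechet_derivative f (at x) v)" using Suc.prems by simp
    then show "Ck_on k S (\<lambda>x. frechet_derivative g (at x) v)"
      by (rule Suc.IH[rotated]) (simp add: frechet_derivative_at[OF der, symmetric])
  qed
qed

lemma Ck_on_SucI:
  assumes "open S" "\<And>x. x \<in> S \<Longrightarrow> (f has_derivative (\<lambda>v. D v x)) (at x)" "\<And>v. Ck_on k S (D v)"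
  shows "Ck_on (Suc k) S f"
  unfolding Ck_on.simps
proof (intro conjI ballI allI)
  fix x assume "x \<in> S" then show "f differentiable (at x)" using assms by (auto simp: differentiable_def)
next
  fix v show "Ck_on k S (\<lambda>x. frechet_derivative f (at x) v)"
    by (rule Ck_on_cong[OF assms(1) _ assms(3)[of v]])
      (simp add: frechet_derivative_at[OF assms(2), symmetric])
qed

lemma Ck_on_SucD:
  assumes "Ck_on (Suc k) S f" "x \<in> S"
  shows "(f has_derivative frechet_derivative f (at x)) (at x)"
  using assms by (simp add: frechet_derivative_works[symmetric])

lemma Ck_on_const: "open S \<Longrightarrow> Ck_on k S (\<lambda>x. a)"
  by (induction k arbitrary: a) auto

lemma Ck_on_add:
  assumes "open S" "Ck_on k S f" "Ck_on k S g"
  shows "Ck_on k S (\<lambda>x. f x + g x)"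
  using assms(2,3)
proof (induction k arbitrary: f g)
  case (Suc k)
  show ?case
    by (rule Ck_on_SucI[OF assms(1), of _ "\<lambda>v x. frechet_derivative f (at x) v + frechet_derivative g (at x) v"])
      (use Suc in \<open>auto intro!: has_derivative_add Ck_on_SucD simp del: Ck_on.simps(2)\<close>, simp)
qed (auto intro: continuous_on_add)

lemma Ck_on_mult:
  fixes f g :: "'e::real_normed_vector \<Rightarrow> real"
  assumes "open S" "Ck_on k S f" "Ck_on k S g"
  shows "Ck_on k S (\<lambda>x. f x * g x)"
  using assms(2,3)
proof (induction k arbitrary: f g)
  case (Suc k)
  show ?case
  proof (rule Ck_on_SucI[OF assms(1), of _ "\<lambda>v x. f x * frechet_derivative g (at x) v + frechet_derivative f (at x) v * g x"])
    fix x assume "x \<in> S"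
    then show "((\<lambda>x. f x * g x) has_derivative
        (\<lambda>v. f x * frechet_derivative g (at x) v + frechet_derivative f (at x) v * g x)) (at x)"
      using Suc.prems by (intro has_derivative_mult Ck_on_SucD)
  next
    fix v
    have "Ck_on k S f" "Ck_on k S g" using Suc.prems by (auto intro: Ck_on_Suc_imp)
    then show "Ck_on k S (\<lambda>x. f x * frechet_derivative g (at x) v + frechet_derivative f (at x) v * g x)"
      using Suc.prems by (intro Ck_on_add[OF assms(1)] Suc.IH) auto
  qed
qed (auto intro: continuous_on_mult)

lemma Ck_on_sum:
  assumes "open S" "\<And>i. i \<in> I \<Longrightarrow> Ck_on k S (f i)"
  shows "Ck_on k S (\<lambda>x. \<Sum>i\<in>I. f i x)"
  using assms(2) by (induction I rule: infinite_finite_induct) (auto intro!: Ck_on_add Ck_on_const assms(1))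

lemma Ck_on_bounded_linear:
  assumes "open S" "bounded_linear h" "Ck_on k S f"
  shows "Ck_on k S (\<lambda>x. h (f x))"
  using assms(3)
proof (induction k arbitrary: f)
  case 0
  then show ?case using assms(2) by (auto intro: bounded_linear.continuous_on)
next
  case (Suc k)
  show ?case
  proof (rule Ck_on_SucI[OF assms(1), of _ "\<lambda>v x. h (frechet_derivative f (at x) v)"])
    fix x assume "x \<in> S"
    then show "((\<lambda>x. h (f x)) has_derivative (\<lambda>v. h (frechet_derivative f (at x) v))) (at x)"
      using Suc.prems by (intro bounded_linear.has_derivative[OF assms(2)] Ck_on_SucD)
  qed (use Suc in auto)
qed

lemma Ck_on_compose_affine:
  assumes "open S" "bounded_linear l" "\<And>x. x \<in> S \<Longrightarrow> a + l x \<in> T" "Ck_on k T f"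
  shows "Ck_on k S (\<lambda>x. f (a + l x))"
  using assms(4)
proof (induction k arbitrary: f)
  case 0
  then have "continuous_on T f" by simp
  moreover have "continuous_on S (\<lambda>x. a + l x)"
    by (intro continuous_on_add continuous_on_const linear_continuous_on assms)
  ultimately show ?case using assms(3) by (auto intro: continuous_on_compose2)
next
  case (Suc k)
  show ?case
  proof (rule Ck_on_SucI[OF assms(1), of _ "\<lambda>v x. frechet_derivative f (at (a + l x)) (l v)"])
    fix x assume x: "x \<in> S"
    have "(f has_derivative frechet_derivative f (at (a + l x))) (at (a + l x))"
      using Suc.prems assms(3)[OF x] by (rule Ck_on_SucD)
    moreover have "((\<lambda>x. a + l x) has_derivative l) (at x)"
      using assms(2) by (auto intro!: derivative_eq_intros bounded_linear_imp_has_derivative)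
    ultimately show "((\<lambda>x. f (a + l x)) has_derivative (\<lambda>v. frechet_derivative f (at (a + l x)) (l v))) (at x)"
      by (rule has_derivative_compose[rotated])
  qed (use Suc in auto)
qed

lemma smooth_on_frechet_derivative:
  assumes "smooth_on S f"
  shows "smooth_on S (\<lambda>x. frechet_derivative f (at x) v)"
  using assms unfolding smooth_on_def by (metis Ck_on.simps(2))

lemma smooth_on_imp_continuous_on: "smooth_on S f \<Longrightarrow> continuous_on S f"
  unfolding smooth_on_def using Ck_on_imp_continuous_on by blast

lemma smooth_on_has_derivative:
  assumes "smooth_on S f" "x \<in> S"
  shows "(f has_derivative frechet_derivative f (at x)) (at x)"
  using assms Ck_on_SucD unfolding smooth_on_def by blast

lemma smooth_on_mult:
  fixes f g :: "'e::real_normed_vector \<Rightarrow> real"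
  shows "open S \<Longrightarrow> smooth_on S f \<Longrightarrow> smooth_on S g \<Longrightarrow> smooth_on S (\<lambda>x. f x * g x)"
  by (simp add: smooth_on_def Ck_on_mult)

text \<open>Solutions of a first order system gain regularity: if all \<open>m\<^sub>i\<close> are of class \<open>k\<close>, then so are their
derivatives \<open>D\<^sub>i\<close>, and hence the \<open>m\<^sub>i\<close> are of class \<open>k + 1\<close>.\<close>

lemma smooth_on_bootstrap:
  assumes "open S" "\<And>i x. x \<in> S \<Longrightarrow> (m i has_derivative (\<lambda>v. D i v x)) (at x)"
    and "\<And>k i v. (\<And>j. Ck_on k S (m j)) \<Longrightarrow> Ck_on k S (D i v)"
  shows "smooth_on S (m i)"
proof -
  have "Ck_on k S (m i)" for k i
  proof (induction k arbitrary: i)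
    case 0
    show ?case unfolding Ck_on.simps
      by (rule has_derivative_continuous_on, rule has_derivative_at_withinI, rule assms(2))
  next
    case (Suc k)
    then show ?case by (intro Ck_on_SucI[OF assms(1,2)] assms(3))
  qed
  then show ?thesis by (simp add: smooth_on_def)
qed

section \<open>Homogeneity and the horizontal derivative\<close>

lemma euler_homogeneous:
  fixes p :: "'x::real_normed_vector \<times> 'e::real_normed_vector \<Rightarrow> real"
  assumes der: "(p has_derivative p') (at (x, y))"
    and hom: "\<And>r. r > 0 \<Longrightarrow> p (x, r *\<^sub>R y) = r ^ d * p (x, y)"
  shows "p' (0, y) = d * p (x, y)"
proof -
  have "((\<lambda>r::real. (x, r *\<^sub>R y)) has_derivative (\<lambda>h. (0, h *\<^sub>R y))) (at 1)"
    by (auto intro!: derivative_eq_intros)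
  from has_derivative_compose[OF this, of p p'] der
  have 1: "((\<lambda>r. p (x, r *\<^sub>R y)) has_derivative (\<lambda>h. p' (0, h *\<^sub>R y))) (at 1)" by simp
  have "((\<lambda>r. r ^ d * p (x, y)) has_derivative (\<lambda>h. h * (d * p (x, y)))) (at 1)"
    by (auto intro!: derivative_eq_intros)
  then have "((\<lambda>r. p (x, r *\<^sub>R y)) has_derivative (\<lambda>h. h * (d * p (x, y)))) (at 1)"
    by (rule has_derivative_transform_within_open[of _ _ _ _ "{0<..}"]) (auto simp: hom)
  from has_derivative_unique[OF 1 this] show ?thesis by (metis mult_1 scaleR_one)
qed

lemma frechet_derivative_vertical_homogeneous:
  fixes p :: "'x::real_normed_vector \<times> 'e::real_normed_vector \<Rightarrow> real"
  assumes U: "open U" "x \<in> U" and y: "y \<noteq> 0"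
    and diff: "\<And>x y. x \<in> U \<Longrightarrow> y \<noteq> 0 \<Longrightarrow> p differentiable (at (x, y))"
    and hom: "\<And>x y r. x \<in> U \<Longrightarrow> y \<noteq> 0 \<Longrightarrow> r > 0 \<Longrightarrow> p (x, r *\<^sub>R y) = r ^ Suc d * p (x, y)"
    and r: "r > 0"
  shows "frechet_derivative p (at (x, r *\<^sub>R y)) (0, v) = r ^ d * frechet_derivative p (at (x, y)) (0, v)"
proof -
  let ?D = "\<lambda>y. frechet_derivative p (at (x, y))"
  have 1: "(p has_derivative ?D y) (at (x, y))" if "y \<noteq> 0" for y
    using diff[OF U(2) that] by (simp add: frechet_derivative_works)
  have "((\<lambda>z. (fst z, r *\<^sub>R snd z)) has_derivative (\<lambda>u. (fst u, r *\<^sub>R snd u))) (at (x, y))"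
    by (auto intro!: derivative_eq_intros)
  from has_derivative_compose[OF this, of p "?D (r *\<^sub>R y)"] 1[of "r *\<^sub>R y"] y r
  have 2: "((\<lambda>z. p (fst z, r *\<^sub>R snd z)) has_derivative (\<lambda>u. ?D (r *\<^sub>R y) (fst u, r *\<^sub>R snd u))) (at (x, y))"
    by simp
  have "((\<lambda>z. r ^ Suc d * p z) has_derivative (\<lambda>u. r ^ Suc d * ?D y u)) (at (x, y))"
    by (intro has_derivative_mult_right 1 y)
  then have "((\<lambda>z. p (fst z, r *\<^sub>R snd z)) has_derivative (\<lambda>u. r ^ Suc d * ?D y u)) (at (x, y))"
  proof (rule has_derivative_transform_within_open)
    show "open (U \<times> (- {0::'e}))" by (intro open_Times U) auto
    show "(x, y) \<in> U \<times> - {0}" using U y by simp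
    show "r ^ Suc d * p z = p (fst z, r *\<^sub>R snd z)" if "z \<in> U \<times> - {0}" for z
    proof -
      have "fst z \<in> U" "snd z \<noteq> 0" using that by auto
      from hom[OF this r] show ?thesis by simp
    qed
  qed
  from has_derivative_unique[OF 2 this]
  have "?D (r *\<^sub>R y) (0, r *\<^sub>R v) = r ^ Suc d * ?D y (0, v)" by (auto dest: fun_cong[of _ _ "(0, v)"])
  moreover have "?D (r *\<^sub>R y) (0, r *\<^sub>R v) = r * ?D (r *\<^sub>R y) (0, v)"
  proof -
    have "linear (?D (r *\<^sub>R y))" using 1[of "r *\<^sub>R y"] y r has_derivative_linear by auto
    from linear_scale[OF this, of r "(0, v)"] show ?thesis by simp
  qed
  ultimately show ?thesis using r by simp
qed

lemma vertical_sum: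
  fixes p :: "(real^'n::finite) \<times> (real^'n) \<Rightarrow> real"
  assumes "linear p"
  shows "(\<Sum>i\<in>UNIV. v $ i * p (0, axis i 1)) = p (0, v)"
proof -
  have "(0, v) = (\<Sum>i\<in>UNIV. v $ i *\<^sub>R ((0, axis i 1) :: (real^'n) \<times> (real^'n)))"
    by (simp add: prod_eq_iff fst_sum snd_sum vec_eq_iff axis_def if_distrib[of "\<lambda>x. _ * x"] cong: if_cong)
  then show ?thesis by (simp only: linear_sum[OF assms] linear_scale[OF assms] real_scaleR_def)
qed

lemma axis_sum: "(\<Sum>j\<in>UNIV. axis i 1 $ j * h j) = (h i :: real)"
proof -
  have "(\<Sum>j\<in>UNIV. axis i 1 $ j * h j) = (\<Sum>j\<in>UNIV. if j = i then h j else 0)"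
    by (intro sum.cong) (auto simp: axis_def)
  then show ?thesis by simp
qed

text \<open>With \<open>f = L\<^sup>2\<close> and \<open>q\<^sub>j = \<partial>f/\<partial>y\<^sup>j\<close>, the fundamental tensor is \<open>g\<^sub>i\<^sub>j = 1/2 \<partial>q\<^sub>j/\<partial>y\<^sup>i\<close>. Contraction over the
outer index \<open>i\<close> is Euler's identity for \<open>q\<^sub>j\<close>, which is homogeneous of degree 1. Contraction over the inner
index \<open>j\<close> results from differentiating Euler's identity \<open>y\<^sup>j q\<^sub>j = 2 f\<close> with respect to \<open>y\<^sup>i\<close>.\<close>

lemma fund_euler:
  fixes L :: "(real^'n::finite) \<times> (real^'n) \<Rightarrow> real"
  assumes U: "open U"
    and smooth: "smooth_on (U \<times> (UNIV - {0})) L"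
    and hom: "\<And>x r y. x \<in> U \<Longrightarrow> 0 \<le> r \<Longrightarrow> L (x, r *\<^sub>R y) = r * L (x, y)"
  defines "q \<equiv> \<lambda>j z. frechet_derivative (\<lambda>w. (L w)\<^sup>2) (at z) (0, axis j 1)"
  shows "smooth_on (U \<times> (UNIV - {0})) (fund L i j)"
    and "z \<in> U \<times> (UNIV - {0}) \<Longrightarrow> (\<Sum>i\<in>UNIV. snd z $ i * fund L i j z) = 1/2 * q j z"
    and "z \<in> U \<times> (UNIV - {0}) \<Longrightarrow> (\<Sum>j\<in>UNIV. snd z $ j * fund L i j z) = 1/2 * q i z"
    and "z \<in> U \<times> (UNIV - {0}) \<Longrightarrow>
      (\<Sum>i\<in>UNIV. \<Sum>j\<in>UNIV. (snd z $ i * snd z $ j) * fund L i j z) = (L z)\<^sup>2"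
proof -
  let ?S = "U \<times> (UNIV - {0::real^'n})"
  have opS: "open ?S" by (intro open_Times U open_delete) auto
  define f where "f = (\<lambda>w. (L w)\<^sup>2)"
  have q_def: "q j = (\<lambda>z. frechet_derivative f (at z) (0, axis j 1))" for j
    by (simp add: q_def f_def)
  define g where "g i j = fund L i j" for i j
  have smf: "smooth_on ?S f"
    unfolding f_def power2_eq_square by (intro smooth_on_mult opS smooth)
  have smq: "smooth_on ?S (q j)" for j unfolding q_def by (rule smooth_on_frechet_derivative[OF smf])
  have g: "g i j = (\<lambda>z. 1/2 * frechet_derivative (q j) (at z) (0, axis i 1))" for i j
    by (simp add: g_def fund_def q_def f_def)
  have smg: "smooth_on ?S (g i j)" for i j
  proof -
    have "smooth_on ?S (\<lambda>z. 1/2)" by (simp add: smooth_on_def Ck_on_const opS)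
    then show ?thesis unfolding g by (intro smooth_on_mult opS smooth_on_frechet_derivative smq)
  qed
  have hasd: "(p has_derivative frechet_derivative p (at z)) (at z)" if "smooth_on ?S p" "z \<in> ?S" for p :: "_ \<Rightarrow> real" and z
    using smooth_on_has_derivative that by blast
  have diff: "p differentiable (at (x, y))" if "smooth_on ?S p" "x \<in> U" "y \<noteq> 0" for p :: "_ \<Rightarrow> real" and x y
    using hasd[OF that(1), of "(x, y)"] that by (auto simp: differentiable_def)
  have homf: "f (x, r *\<^sub>R y) = r ^ 2 * f (x, y)" if "x \<in> U" "r > 0" for x r y
    using that by (simp add: f_def hom power_mult_distrib)
  have homq: "q j (x, r *\<^sub>R y) = r ^ 1 * q j (x, y)" if "x \<in> U" "r > 0" "y \<noteq> 0" for x r y j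
    unfolding q_def
    by (rule frechet_derivative_vertical_homogeneous[OF U that(1,3) _ _ that(2)])
      (auto intro!: diff smf simp: homf power2_eq_square)
  have lin: "linear (frechet_derivative p (at z))" if "smooth_on ?S p" "z \<in> ?S" for p :: "_ \<Rightarrow> real" and z
    using hasd[OF that] has_derivative_linear by blast
  have f_q: "(\<Sum>j\<in>UNIV. snd z $ j * q j z) = 2 * f z" if z: "z \<in> ?S" for z
    using vertical_sum[OF lin[OF smf z], of "snd z"] euler_homogeneous[of f _ "fst z" "snd z" 2, OF _ homf]
      hasd[OF smf z] z by (auto simp: q_def)
  have g1: "(\<Sum>i\<in>UNIV. snd z $ i * g i j z) = 1/2 * q j z" if z: "z \<in> ?S" for j z
  proof -
    have "(\<Sum>i\<in>UNIV. snd z $ i * g i j z) = 1/2 * (\<Sum>i\<in>UNIV. snd z $ i * frechet_derivative (q j) (at z) (0, axis i 1))"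
      unfolding g sum_distrib_left by (rule sum.cong) auto
    also have "\<dots> = 1/2 * q j z"
    proof -
      have zz: "fst z \<in> U" "snd z \<noteq> 0" using z by auto
      show ?thesis
        using vertical_sum[OF lin[OF smq z], of "snd z"] hasd[OF smq z, of j]
          euler_homogeneous[of "q j" _ "fst z" "snd z" 1, OF _ homq[OF zz(1) _ zz(2)]] by simp
    qed
    finally show ?thesis .
  qed
  have transfer: "frechet_derivative a (at z) = b" if "z \<in> ?S" "\<And>z. z \<in> ?S \<Longrightarrow> c z = a z"
    "(c has_derivative b) (at z)" for a b c :: "_ \<Rightarrow> real" and z
    using has_derivative_transform_within_open[OF that(3) opS that(1,2)]
    by (rule frechet_derivative_at[symmetric])
  have dsnd: "((\<lambda>z. snd z $ j) has_derivative (\<lambda>u. snd u $ j)) (at z)" for j and z :: "(real^'n) \<times> (real^'n)"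
    by (intro bounded_linear_imp_has_derivative bounded_linear_compose[OF bounded_linear_vec_nth bounded_linear_snd])
  have g2: "(\<Sum>j\<in>UNIV. snd z $ j * g i j z) = 1/2 * q i z" if z: "z \<in> ?S" for i z
  proof -
    have "((\<lambda>z. 1/2 * (\<Sum>j\<in>UNIV. snd z $ j * q j z)) has_derivative
       (\<lambda>u. 1/2 * (\<Sum>j\<in>UNIV. snd z $ j * frechet_derivative (q j) (at z) u + snd u $ j * q j z))) (at z)"
      by (intro has_derivative_mult_right has_derivative_sum has_derivative_mult dsnd hasd smq z)
    then have "frechet_derivative f (at z) = 
       (\<lambda>u. 1/2 * (\<Sum>j\<in>UNIV. snd z $ j * frechet_derivative (q j) (at z) u + snd u $ j * q j z))"
      by (rule transfer[OF z, rotated]) (simp add: f_q)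
    then have "q i z = 1/2 * (\<Sum>j\<in>UNIV. snd z $ j * frechet_derivative (q j) (at z) (0, axis i 1) + axis i 1 $ j * q j z)"
      unfolding q_def[of i] by simp
    also have "\<dots> = (\<Sum>j\<in>UNIV. snd z $ j * g i j z) + 1/2 * q i z"
      unfolding g by (simp only: sum.distrib axis_sum distrib_left) (simp add: sum_divide_distrib)
    finally show ?thesis by simp
  qed
  have g3: "(\<Sum>i\<in>UNIV. \<Sum>j\<in>UNIV. (snd z $ i * snd z $ j) * g i j z) = f z" if z: "z \<in> ?S" for z
  proof -
    have "(\<Sum>i\<in>UNIV. \<Sum>j\<in>UNIV. (snd z $ i * snd z $ j) * g i j z) = (\<Sum>i\<in>UNIV. snd z $ i * (\<Sum>j\<in>UNIV. snd z $ j * g i j z))"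
      by (simp add: sum_distrib_left mult.assoc)
    also have "\<dots> = 1/2 * (\<Sum>i\<in>UNIV. snd z $ i * q i z)" by (simp add: g2[OF z] sum_divide_distrib)
    finally show ?thesis by (simp add: f_q[OF z])
  qed
  show "smooth_on ?S (fund L i j)" using smg by (simp add: g_def)
  show "(\<Sum>i\<in>UNIV. snd z $ i * fund L i j z) = 1/2 * q j z"
    "(\<Sum>j\<in>UNIV. snd z $ j * fund L i j z) = 1/2 * q i z"
    "(\<Sum>i\<in>UNIV. \<Sum>j\<in>UNIV. (snd z $ i * snd z $ j) * fund L i j z) = (L z)\<^sup>2" if "z \<in> ?S"
    using g1[OF that] g2[OF that] g3[OF that] by (simp_all add: g_def f_def)
qed

text \<open>Differentiating \<open>g\<^sub>i\<^sub>j y\<^sup>i y\<^sup>j = L\<^sup>2\<close> in the direction of \<open>y\<^sup>k\<close> and using both contractions of \<open>g\<close> with \<open>y\<close> gives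
\<open>y\<^sup>i y\<^sup>j \<partial>g\<^sub>i\<^sub>j/\<partial>y\<^sup>k = 0\<close>. Therefore the Cartan tensor, and with it the factor \<open>T\<close>, which stands for
\<open>\<delta>y\<^sup>k/F\<close>, disappears when the compatibility condition is contracted with \<open>y\<^sup>i y\<^sup>j\<close>. The two connection
terms are equal after this contraction, each being half of the derivative of \<open>L\<^sup>2\<close> along the vertical
vector \<open>\<omega>(\<xi>) y\<close>.\<close>

lemma energy_horizontal_derivative:
  fixes L :: "(real^'n::finite) \<times> (real^'n) \<Rightarrow> real" and om :: "(real^'n) \<times> (real^'n) \<Rightarrow> real^'n^'n"
  assumes U: "open U" and x: "x \<in> U" and y: "y \<noteq> 0"
    and smooth: "smooth_on (U \<times> (UNIV - {0})) L"
    and hom: "\<And>x r y. x \<in> U \<Longrightarrow> 0 \<le> r \<Longrightarrow> L (x, r *\<^sub>R y) = r * L (x, y)"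
    and compat: "\<And>i j. frechet_derivative (fund L i j) (at (x, y)) (\<xi>, 0)
            - (\<Sum>k\<in>UNIV. fund L k j (x, y) * om (\<xi>, 0) $ k $ i)
            - (\<Sum>k\<in>UNIV. fund L i k (x, y) * om (\<xi>, 0) $ k $ j)
          = (\<Sum>k\<in>UNIV. 2 * cartan L i j k (x, y) * T k)"
  shows "frechet_derivative (\<lambda>w. (L w)\<^sup>2) (at (x, y)) (\<xi>, 0) =
      frechet_derivative (\<lambda>w. (L w)\<^sup>2) (at (x, y)) (0, om (\<xi>, 0) *v y)"
proof -
  let ?S = "U \<times> (UNIV - {0::real^'n})" and ?z = "(x, y)"
  have opS: "open ?S" by (intro open_Times U open_delete) auto
  have z: "?z \<in> ?S" using x y by simp
  define f where "f = (\<lambda>w. (L w)\<^sup>2)"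
  define q where "q j = (\<lambda>z. frechet_derivative f (at z) (0, axis j 1))" for j
  define g where "g i j = fund L i j" for i j
  have euler: "smooth_on ?S (g i j)"
    "z \<in> ?S \<Longrightarrow> (\<Sum>i\<in>UNIV. snd z $ i * g i j z) = 1/2 * q j z"
    "z \<in> ?S \<Longrightarrow> (\<Sum>j\<in>UNIV. snd z $ j * g i j z) = 1/2 * q i z"
    "z \<in> ?S \<Longrightarrow> (\<Sum>i\<in>UNIV. \<Sum>j\<in>UNIV. (snd z $ i * snd z $ j) * g i j z) = f z" for i j z
    unfolding g_def q_def f_def using fund_euler[OF U smooth hom] by blast+
  have smf: "smooth_on ?S f"
    unfolding f_def power2_eq_square by (intro smooth_on_mult opS smooth)
  have linf: "linear (frechet_derivative f (at ?z))"
    using smooth_on_has_derivative[OF smf z] has_derivative_linear by blast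
  have hasg: "(g i j has_derivative frechet_derivative (g i j) (at ?z)) (at ?z)" for i j
    by (rule smooth_on_has_derivative[OF euler(1) z])
  have dsnd: "((\<lambda>z. snd z $ j) has_derivative (\<lambda>u. snd u $ j)) (at z)" for j and z :: "(real^'n) \<times> (real^'n)"
    by (intro bounded_linear_imp_has_derivative bounded_linear_compose[OF bounded_linear_vec_nth bounded_linear_snd])
  have Df: "frechet_derivative f (at ?z) u = (\<Sum>i\<in>UNIV. \<Sum>j\<in>UNIV.
     (y $ i * y $ j) * frechet_derivative (g i j) (at ?z) u + (y $ i * snd u $ j + snd u $ i * y $ j) * g i j ?z)" for u
  proof -
    have "((\<lambda>z. \<Sum>i\<in>UNIV. \<Sum>j\<in>UNIV. (snd z $ i * snd z $ j) * g i j z) has_derivative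
      (\<lambda>u. \<Sum>i\<in>UNIV. \<Sum>j\<in>UNIV. (snd ?z $ i * snd ?z $ j) * frechet_derivative (g i j) (at ?z) u +
         (snd ?z $ i * snd u $ j + snd u $ i * snd ?z $ j) * g i j ?z)) (at ?z)"
      by (intro has_derivative_sum has_derivative_mult dsnd hasg)
    then have "frechet_derivative f (at ?z) = (\<lambda>u. \<Sum>i\<in>UNIV. \<Sum>j\<in>UNIV. (snd ?z $ i * snd ?z $ j) * frechet_derivative (g i j) (at ?z) u +
         (snd ?z $ i * snd u $ j + snd u $ i * snd ?z $ j) * g i j ?z)"
      by (intro frechet_derivative_at[symmetric], rule has_derivative_transform_within_open[OF _ opS z])
        (rule euler(4))
    then show ?thesis by simp
  qed
  have cartan0: "(\<Sum>i\<in>UNIV. \<Sum>j\<in>UNIV. (y $ i * y $ j) * frechet_derivative (g i j) (at ?z) (0, axis k 1)) = 0" for k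
  proof -
    have "(\<Sum>i\<in>UNIV. \<Sum>j\<in>UNIV. (y $ i * axis k 1 $ j + axis k 1 $ i * y $ j) * g i j ?z) =
      (\<Sum>i\<in>UNIV. y $ i * g i k ?z) + (\<Sum>j\<in>UNIV. y $ j * g k j ?z)"
    proof -
      have "(\<Sum>i\<in>UNIV. \<Sum>j\<in>UNIV. (y $ i * axis k 1 $ j + axis k 1 $ i * y $ j) * g i j ?z) =
        (\<Sum>i\<in>UNIV. \<Sum>j\<in>UNIV. (if j = k then y $ i * g i j ?z else 0)) + (\<Sum>i\<in>UNIV. \<Sum>j\<in>UNIV. (if i = k then y $ j * g i j ?z else 0))"
        unfolding sum.distrib[symmetric] by (intro sum.cong) (auto simp: axis_def algebra_simps)
      also have "(\<Sum>i\<in>UNIV. \<Sum>j\<in>UNIV. (if i = k then y $ j * g i j ?z else 0)) = (\<Sum>j\<in>UNIV. y $ j * g k j ?z)"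
        by (subst sum.swap) simp
      finally show ?thesis by simp
    qed
    also have "\<dots> = q k ?z" using euler(2)[OF z, of k] euler(3)[OF z, of k] by simp
    finally show ?thesis
      using Df[of "(0, axis k 1)"] by (simp add: q_def sum.distrib)
  qed
  have half: "(\<Sum>i\<in>UNIV. y $ i * g i k ?z) = 1/2 * q k ?z" "(\<Sum>j\<in>UNIV. y $ j * g k j ?z) = 1/2 * q k ?z" for k
    using euler(2)[OF z, of k] euler(3)[OF z, of k] by simp_all
  have "frechet_derivative f (at ?z) (\<xi>, 0) = (\<Sum>i\<in>UNIV. \<Sum>j\<in>UNIV. (y $ i * y $ j) * frechet_derivative (g i j) (at ?z) (\<xi>, 0))"
    using Df[of "(\<xi>, 0)"] by simp
  also have "\<dots> = (\<Sum>i\<in>UNIV. \<Sum>j\<in>UNIV. (y $ i * y $ j) * (\<Sum>k\<in>UNIV. g k j ?z * om (\<xi>, 0) $ k $ i)) +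
      (\<Sum>i\<in>UNIV. \<Sum>j\<in>UNIV. (y $ i * y $ j) * (\<Sum>k\<in>UNIV. g i k ?z * om (\<xi>, 0) $ k $ j)) +
      (\<Sum>i\<in>UNIV. \<Sum>j\<in>UNIV. (y $ i * y $ j) * (\<Sum>k\<in>UNIV. 2 * cartan L i j k ?z * T k))"
  proof -
    have "frechet_derivative (g i j) (at ?z) (\<xi>, 0) = (\<Sum>k\<in>UNIV. g k j ?z * om (\<xi>, 0) $ k $ i) +
       (\<Sum>k\<in>UNIV. g i k ?z * om (\<xi>, 0) $ k $ j) + (\<Sum>k\<in>UNIV. 2 * cartan L i j k ?z * T k)" for i j
      using compat[of i j] unfolding g_def by linarith
    then show ?thesis by (simp only: distrib_left sum.distrib)
  qed
  also have "(\<Sum>i\<in>UNIV. \<Sum>j\<in>UNIV. (y $ i * y $ j) * (\<Sum>k\<in>UNIV. 2 * cartan L i j k ?z * T k)) =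
      (\<Sum>k\<in>UNIV. L ?z * T k * (\<Sum>i\<in>UNIV. \<Sum>j\<in>UNIV. (y $ i * y $ j) * frechet_derivative (g i j) (at ?z) (0, axis k 1)))"
  proof -
    have "(\<Sum>i\<in>UNIV. \<Sum>j\<in>UNIV. (y $ i * y $ j) * (\<Sum>k\<in>UNIV. 2 * cartan L i j k ?z * T k)) =
      (\<Sum>i\<in>UNIV. \<Sum>k\<in>UNIV. \<Sum>j\<in>UNIV. (y $ i * y $ j) * (2 * cartan L i j k ?z * T k))"
      unfolding sum_distrib_left by (intro sum.cong refl sum.swap)
    also have "\<dots> = (\<Sum>k\<in>UNIV. \<Sum>i\<in>UNIV. \<Sum>j\<in>UNIV. (y $ i * y $ j) * (2 * cartan L i j k ?z * T k))"
      by (rule sum.swap)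
    finally show ?thesis
      unfolding cartan_def g_def[symmetric] sum_distrib_left by (simp add: algebra_simps)
  qed
  also have "\<dots> = 0" by (simp add: cartan0)
  also have "(\<Sum>i\<in>UNIV. \<Sum>j\<in>UNIV. (y $ i * y $ j) * (\<Sum>k\<in>UNIV. g k j ?z * om (\<xi>, 0) $ k $ i)) =
     (\<Sum>k\<in>UNIV. (\<Sum>i\<in>UNIV. om (\<xi>, 0) $ k $ i * y $ i) * (\<Sum>j\<in>UNIV. y $ j * g k j ?z))"
  proof -
    have "(\<Sum>i\<in>UNIV. \<Sum>j\<in>UNIV. (y $ i * y $ j) * (\<Sum>k\<in>UNIV. g k j ?z * om (\<xi>, 0) $ k $ i)) =
      (\<Sum>i\<in>UNIV. \<Sum>k\<in>UNIV. \<Sum>j\<in>UNIV. (y $ i * y $ j) * (g k j ?z * om (\<xi>, 0) $ k $ i))"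
      unfolding sum_distrib_left by (intro sum.cong refl sum.swap)
    also have "\<dots> = (\<Sum>k\<in>UNIV. \<Sum>i\<in>UNIV. \<Sum>j\<in>UNIV. (y $ i * y $ j) * (g k j ?z * om (\<xi>, 0) $ k $ i))"
      by (rule sum.swap)
    finally show ?thesis unfolding sum_product by (simp add: algebra_simps)
  qed
  also have "(\<Sum>i\<in>UNIV. \<Sum>j\<in>UNIV. (y $ i * y $ j) * (\<Sum>k\<in>UNIV. g i k ?z * om (\<xi>, 0) $ k $ j)) =
     (\<Sum>k\<in>UNIV. (\<Sum>j\<in>UNIV. om (\<xi>, 0) $ k $ j * y $ j) * (\<Sum>i\<in>UNIV. y $ i * g i k ?z))"
  proof -
    have "(\<Sum>i\<in>UNIV. \<Sum>j\<in>UNIV. (y $ i * y $ j) * (\<Sum>k\<in>UNIV. g i k ?z * om (\<xi>, 0) $ k $ j)) =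
      (\<Sum>j\<in>UNIV. \<Sum>i\<in>UNIV. \<Sum>k\<in>UNIV. (y $ i * y $ j) * (g i k ?z * om (\<xi>, 0) $ k $ j))"
      unfolding sum_distrib_left by (rule sum.swap)
    also have "\<dots> = (\<Sum>j\<in>UNIV. \<Sum>k\<in>UNIV. \<Sum>i\<in>UNIV. (y $ i * y $ j) * (g i k ?z * om (\<xi>, 0) $ k $ j))"
      by (intro sum.cong refl sum.swap)
    also have "\<dots> = (\<Sum>k\<in>UNIV. \<Sum>j\<in>UNIV. \<Sum>i\<in>UNIV. (y $ i * y $ j) * (g i k ?z * om (\<xi>, 0) $ k $ j))"
      by (rule sum.swap)
    finally show ?thesis unfolding sum_product by (simp add: algebra_simps)
  qed
  finally have "frechet_derivative f (at ?z) (\<xi>, 0) = (\<Sum>k\<in>UNIV. (om (\<xi>, 0) *v y) $ k * q k ?z)"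
    by (simp only: half matrix_vector_mult_def sum.distrib[symmetric] vec_lambda_beta) (simp add: mult.commute)
  also have "\<dots> = frechet_derivative f (at ?z) (0, om (\<xi>, 0) *v y)"
    unfolding q_def by (rule vertical_sum[OF linf])
  finally show "frechet_derivative (\<lambda>w. (L w)\<^sup>2) (at (x, y)) (\<xi>, 0) =
      frechet_derivative (\<lambda>w. (L w)\<^sup>2) (at (x, y)) (0, om (\<xi>, 0) *v y)"
    by (simp add: f_def)
qed

text \<open>Lowering the first index of \<open>\<Delta>\<close> produces a tensor that is skew in the first two indices and symmetric in
the last two; such a tensor vanishes. The index is lowered with the symmetrised form \<open>g\<^sub>i\<^sub>j + g\<^sub>j\<^sub>i\<close>, which
is nondegenerate because its quadratic form is positive.\<close>

lemma metric_torsion_free_unique: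
  fixes g :: "'n::finite \<Rightarrow> 'n \<Rightarrow> real" and \<Delta> :: "'n \<Rightarrow> 'n \<Rightarrow> 'n \<Rightarrow> real"
  assumes pos: "\<And>\<xi>::real^'n. \<xi> \<noteq> 0 \<Longrightarrow> (\<Sum>i\<in>UNIV. \<Sum>j\<in>UNIV. g i j * \<xi> $ i * \<xi> $ j) > 0"
    and sym: "\<And>i j k. \<Delta> i j k = \<Delta> i k j"
    and metric: "\<And>i j l. (\<Sum>k\<in>UNIV. g k j * \<Delta> k i l) + (\<Sum>k\<in>UNIV. g i k * \<Delta> k j l) = 0"
  shows "\<Delta> i j k = 0"
proof -
  define a where "a j i l = (\<Sum>k\<in>UNIV. (g k j + g j k) * \<Delta> k i l)" for j i l
  have skew: "a j i l = - a i j l" for i j l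
    using metric[of j i l] metric[of i j l] by (simp add: a_def distrib_right sum.distrib)
  have asym: "a j i l = a j l i" for i j l unfolding a_def by (subst sym) simp
  have a0: "a j i l = 0" for i j l
    using skew[of j i l] asym[of i j l] skew[of i l j] asym[of l i j] skew[of l j i] asym[of j l i] by linarith
  define w :: "real^'n" where "w = (\<chi> i. \<Delta> i j k)"
  have "0 = (\<Sum>l\<in>UNIV. w $ l * a l j k)" by (simp add: a0)
  also have "\<dots> = (\<Sum>l\<in>UNIV. \<Sum>i\<in>UNIV. g i l * w $ i * w $ l) + (\<Sum>l\<in>UNIV. \<Sum>i\<in>UNIV. g l i * w $ l * w $ i)"
    unfolding a_def sum_distrib_left sum.distrib[symmetric]
    by (intro sum.cong refl) (simp add: w_def algebra_simps)
  also have "(\<Sum>l\<in>UNIV. \<Sum>i\<in>UNIV. g i l * w $ i * w $ l) = (\<Sum>i\<in>UNIV. \<Sum>l\<in>UNIV. g i l * w $ i * w $ l)"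
    by (rule sum.swap)
  finally have "w = 0" using pos[of w] by fastforce
  then show ?thesis by (simp add: w_def vec_eq_iff)
qed

section \<open>Changes of coordinates and tangent vectors\<close>

lemma chart_dom_topspace:
  assumes "smooth_manifold X \<A>" "c \<in> \<A>"
  shows "chart_dom c \<subseteq> topspace X"
  using assms by (meson openin_subset smooth_manifold_def)

lemma chart_inj:
  assumes "smooth_manifold X \<A>" "c \<in> \<A>"
  shows "inj_on (snd c) (chart_dom c)"
proof -
  have "homeomorphic_map (subtopology X (chart_dom c)) (top_of_set (chart_img c)) (snd c)"
    using assms by (simp add: smooth_manifold_def)
  from homeomorphic_imp_injective_map[OF this] show ?thesis
    using chart_dom_topspace[OF assms] by (simp add: Int_absorb1)
qed

lemma chart_img_open: "smooth_manifold X \<A> \<Longrightarrow> c \<in> \<A> \<Longrightarrow> open (chart_img c)"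
  by (simp add: smooth_manifold_def)

lemma chart_inv_chart:
  assumes "smooth_manifold X \<A>" "c \<in> \<A>" "p \<in> chart_dom c"
  shows "chart_inv c (snd c p) = p"
  using chart_inj[OF assms(1,2)] assms(3) by (simp add: chart_inv_def)

lemma chart_chart_inv:
  assumes "x \<in> chart_img c"
  shows "chart_inv c x \<in> chart_dom c" "snd c (chart_inv c x) = x"
  using assms by (auto simp: chart_inv_def chart_img_def intro: inv_into_into f_inv_into_f)

lemma overlap_iff:
  assumes "smooth_manifold X \<A>" "c \<in> \<A>"
  shows "x \<in> overlap c d \<longleftrightarrow> x \<in> chart_img c \<and> chart_inv c x \<in> chart_dom d"
proof
  assume "x \<in> overlap c d"
  then obtain p where p: "p \<in> chart_dom c" "p \<in> chart_dom d" "x = snd c p" by (auto simp: overlap_def)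
  then show "x \<in> chart_img c \<and> chart_inv c x \<in> chart_dom d"
    using chart_inv_chart[OF assms p(1)] by (simp add: chart_img_def)
next
  assume "x \<in> chart_img c \<and> chart_inv c x \<in> chart_dom d"
  then show "x \<in> overlap c d" unfolding overlap_def using chart_chart_inv[of x c] by (metis IntI image_eqI)
qed

lemma overlap_self: "overlap c c = chart_img c"
  by (simp add: overlap_def chart_img_def)

lemma overlap_open:
  assumes "smooth_manifold X \<A>" "c \<in> \<A>" "d \<in> \<A>"
  shows "open (overlap c d)"
proof -
  have h: "homeomorphic_map (subtopology X (chart_dom c)) (top_of_set (chart_img c)) (snd c)"
    using assms by (simp add: smooth_manifold_def)
  have t: "topspace (subtopology X (chart_dom c)) = chart_dom c"
    using chart_dom_topspace[OF assms(1,2)] by (simp add: Int_absorb1)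
  have "openin X (chart_dom d)" using assms by (simp add: smooth_manifold_def)
  then have "openin (subtopology X (chart_dom c)) (chart_dom c \<inter> chart_dom d)"
    by (metis inf_commute openin_subtopology_Int)
  then have "openin (top_of_set (chart_img c)) (overlap c d)"
    unfolding overlap_def using homeomorphic_map_openness[OF h, of "chart_dom c \<inter> chart_dom d"] t
      chart_dom_topspace[OF assms(1,2)] by (simp add: le_infI1)
  then show ?thesis using chart_img_open[OF assms(1,2)] openin_open_trans by blast
qed

lemma transition_overlap:
  assumes "smooth_manifold X \<A>" "c \<in> \<A>" "d \<in> \<A>" "x \<in> overlap c d"
  shows "chart_inv d (transition c d x) = chart_inv c x" "transition c d x \<in> overlap d c"
    "transition c d x = snd d (chart_inv c x)"
proof -
  have p: "chart_inv c x \<in> chart_dom c" "chart_inv c x \<in> chart_dom d"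
    using assms(4) overlap_iff[OF assms(1,2)] chart_chart_inv[of x c] by auto
  show 1: "transition c d x = snd d (chart_inv c x)" by (simp add: transition_def)
  show "chart_inv d (transition c d x) = chart_inv c x"
    unfolding 1 by (rule chart_inv_chart[OF assms(1,3) p(2)])
  show "transition c d x \<in> overlap d c" unfolding 1 overlap_def using p by blast
qed

lemma transition_derivative:
  assumes "smooth_manifold X \<A>" "c \<in> \<A>" "d \<in> \<A>" "x \<in> overlap c d"
  shows "(transition c d has_derivative frechet_derivative (transition c d) (at x)) (at x)"
proof -
  have "smooth_on (overlap c d) (transition c d)" using assms by (simp add: smooth_manifold_def)
  then show ?thesis using assms(4) by (rule smooth_on_has_derivative)
qed

lemma transition_linear:
  assumes "smooth_manifold X \<A>" "c \<in> \<A>" "d \<in> \<A>" "x \<in> overlap c d"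
  shows "linear (frechet_derivative (transition c d) (at x))"
  using transition_derivative[OF assms] has_derivative_linear by blast

lemma transition_chain:
  assumes M: "smooth_manifold X \<A>" and A: "c \<in> \<A>" "d \<in> \<A>" "e \<in> \<A>"
    and x: "x \<in> overlap c d" "x \<in> overlap c e"
  shows "frechet_derivative (transition c e) (at x) v =
    frechet_derivative (transition d e) (at (transition c d x)) (frechet_derivative (transition c d) (at x) v)"
proof -
  have x': "transition c d x \<in> overlap d e"
    using x overlap_iff[OF M A(1)] overlap_iff[OF M A(2)] transition_overlap[OF M A(1,2) x(1)] by auto
  have "((\<lambda>x. transition d e (transition c d x)) has_derivative
     (\<lambda>v. frechet_derivative (transition d e) (at (transition c d x)) (frechet_derivative (transition c d) (at x) v))) (at x)"
    by (rule has_derivative_compose[OF transition_derivative[OF M A(1,2) x(1)] transition_derivative[OF M A(2,3) x']])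
  then have "(transition c e has_derivative
     (\<lambda>v. frechet_derivative (transition d e) (at (transition c d x)) (frechet_derivative (transition c d) (at x) v))) (at x)"
  proof (rule has_derivative_transform_within_open)
    show "open (overlap c d \<inter> overlap c e)" by (intro open_Int overlap_open[OF M] A)
    show "x \<in> overlap c d \<inter> overlap c e" using x by simp
    show "transition d e (transition c d z) = transition c e z" if "z \<in> overlap c d \<inter> overlap c e" for z
      using transition_overlap(1)[OF M A(1,2), of z] that by (simp add: transition_def[of d e] transition_def[of c e])
  qed
  from fun_cong[OF frechet_derivative_at[OF this], of v] show ?thesis by simp
qed

lemma transition_self:
  assumes M: "smooth_manifold X \<A>" and A: "c \<in> \<A>" and x: "x \<in> chart_img c"
  shows "frechet_derivative (transition c c) (at x) v = v"
proof -
  have "((\<lambda>x. x) has_derivative (\<lambda>v. v)) (at x)" by (rule has_derivative_ident)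
  then have "(transition c c has_derivative (\<lambda>v. v)) (at x)"
    by (rule has_derivative_transform_within_open[OF _ chart_img_open[OF M A] x])
      (simp add: transition_def chart_chart_inv)
  from fun_cong[OF frechet_derivative_at[OF this], of v] show ?thesis by simp
qed

lemma transition_inverse:
  assumes M: "smooth_manifold X \<A>" and A: "c \<in> \<A>" "d \<in> \<A>" and x: "x \<in> overlap c d"
  shows "frechet_derivative (transition d c) (at (transition c d x)) (frechet_derivative (transition c d) (at x) v) = v"
proof -
  have xi: "x \<in> chart_img c" using x overlap_iff[OF M A(1)] by simp
  then have "x \<in> overlap c c" by (simp add: overlap_self)
  from transition_chain[OF M A A(1) x this, of v] transition_self[OF M A(1) xi] show ?thesis by simp
qed

lemma transition_inverse_point:
  assumes M: "smooth_manifold X \<A>" and A: "c \<in> \<A>" "d \<in> \<A>" and x: "x \<in> overlap c d"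
  shows "transition d c (transition c d x) = x"
proof -
  have "x \<in> chart_img c" using x overlap_iff[OF M A(1)] by simp
  then show ?thesis
    using transition_overlap(1)[OF M A x] chart_chart_inv(2) by (simp add: transition_def[of d c])
qed

lemma coord_vec_chart:
  assumes M: "smooth_manifold X \<A>" and A: "c \<in> \<A>" and x: "x \<in> chart_img c"
  shows "coord_vec \<A> c x y c = y"
  using transition_self[OF M A x] chart_chart_inv(1)[OF x] A by (simp add: coord_vec_def)

lemma coord_vec_tangent:
  assumes M: "smooth_manifold X \<A>" and A: "c \<in> \<A>" and x: "x \<in> chart_img c"
  shows "coord_vec \<A> c x y \<in> tangent_space \<A> (chart_inv c x)"
  unfolding tangent_space_def
proof (intro CollectI conjI allI ballI impI)
  fix d assume "d \<notin> \<A> \<or> chart_inv c x \<notin> chart_dom d"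
  then show "coord_vec \<A> c x y d = 0" by (auto simp: coord_vec_def)
next
  fix d e assume d: "d \<in> \<A>" and e: "e \<in> \<A>" and p: "chart_inv c x \<in> chart_dom d \<and> chart_inv c x \<in> chart_dom e"
  have xd: "x \<in> overlap c d" and xe: "x \<in> overlap c e" using p x overlap_iff[OF M A] by auto
  show "coord_vec \<A> c x y e = frechet_derivative (transition d e) (at (snd d (chart_inv c x))) (coord_vec \<A> c x y d)"
    using transition_chain[OF M A d e xd xe] p d e transition_overlap(3)[OF M A d xd]
    by (simp add: coord_vec_def)
qed

text \<open>A tangent vector is determined by its components in one chart.\<close>

lemma coord_vec_of_tangent:
  assumes M: "smooth_manifold X \<A>" and A: "c \<in> \<A>" and p: "p \<in> chart_dom c" and v: "v \<in> tangent_space \<A> p"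
  shows "coord_vec \<A> c (snd c p) (v c) = v"
proof
  fix d show "coord_vec \<A> c (snd c p) (v c) d = v d"
  proof (cases "d \<in> \<A> \<and> p \<in> chart_dom d")
    case True
    then have "v d = frechet_derivative (transition c d) (at (snd c p)) (v c)"
      using v A p unfolding tangent_space_def by blast
    then show ?thesis using True chart_inv_chart[OF M A p] by (simp add: coord_vec_def)
  next
    case False
    then have "v d = 0" using v unfolding tangent_space_def by blast
    then show ?thesis using False chart_inv_chart[OF M A p] by (auto simp: coord_vec_def)
  qed
qed

lemma coord_vec_change_chart:
  assumes M: "smooth_manifold X \<A>" and A: "c \<in> \<A>" "d \<in> \<A>" and x: "x \<in> overlap c d"
  shows "coord_vec \<A> d (transition c d x) (frechet_derivative (transition c d) (at x) y) = coord_vec \<A> c x y"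
proof -
  have xi: "x \<in> chart_img c" and pd: "chart_inv c x \<in> chart_dom d" using x overlap_iff[OF M A(1)] by auto
  have "coord_vec \<A> d (snd d (chart_inv c x)) (coord_vec \<A> c x y d) = coord_vec \<A> c x y"
    by (rule coord_vec_of_tangent[OF M A(2) pd coord_vec_tangent[OF M A(1) xi]])
  moreover have "coord_vec \<A> c x y d = frechet_derivative (transition c d) (at x) y"
    using A pd by (simp add: coord_vec_def)
  ultimately show ?thesis by (simp add: transition_overlap(3)[OF M A x])
qed

lemma coord_vec_scale:
  assumes M: "smooth_manifold X \<A>" and A: "c \<in> \<A>" and x: "x \<in> chart_img c"
  shows "coord_vec \<A> c x (r *\<^sub>R y) = (\<lambda>d. r *\<^sub>R coord_vec \<A> c x y d)"
proof
  fix d show "coord_vec \<A> c x (r *\<^sub>R y) d = r *\<^sub>R coord_vec \<A> c x y d"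
    using linear_scale[OF transition_linear[OF M A _, of d x]] x overlap_iff[OF M A]
    by (simp add: coord_vec_def)
qed

section \<open>The Finsler function and the Chern-Rund connection in coordinates\<close>

lemma finsler_manifold: "finsler_space X \<A> F \<Longrightarrow> smooth_manifold X \<A>"
  by (simp add: finsler_space_def)

lemma fin_coord_change_chart:
  assumes F: "finsler_space X \<A> F" and A: "c \<in> \<A>" "d \<in> \<A>" and x: "x \<in> overlap c d"
  shows "fin_coord \<A> F c (x, y) =
    fin_coord \<A> F d (transition c d x, frechet_derivative (transition c d) (at x) y)"
  using coord_vec_change_chart[OF finsler_manifold[OF F] A x]
    transition_overlap(1)[OF finsler_manifold[OF F] A x]
  by (simp add: fin_coord_def)

lemma fin_coord_homogeneous:
  assumes F: "finsler_space X \<A> F" and A: "c \<in> \<A>" and x: "x \<in> chart_img c" and r: "0 \<le> r"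
  shows "fin_coord \<A> F c (x, r *\<^sub>R y) = r * fin_coord \<A> F c (x, y)"
proof -
  note M = finsler_manifold[OF F]
  have "chart_inv c x \<in> topspace X" using chart_chart_inv(1)[OF x] chart_dom_topspace[OF M A] by blast
  then show ?thesis
    using F r coord_vec_tangent[OF M A x] coord_vec_scale[OF M A x]
    by (simp add: fin_coord_def finsler_space_def)
qed

lemma fin_coord_smooth: "finsler_space X \<A> F \<Longrightarrow> c \<in> \<A> \<Longrightarrow> smooth_on (slit c) (fin_coord \<A> F c)"
  by (simp add: finsler_space_def)

lemma fund_pos:
  "finsler_space X \<A> F \<Longrightarrow> c \<in> \<A> \<Longrightarrow> z \<in> slit c \<Longrightarrow> \<xi> \<noteq> 0 \<Longrightarrow>
    (\<Sum>i\<in>UNIV. \<Sum>j\<in>UNIV. fund (fin_coord \<A> F c) i j z * \<xi> $ i * \<xi> $ j) > 0"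
  by (simp add: finsler_space_def)

lemma chern_rund_torsion:
  assumes "chern_rund_connection \<A> F \<omega>" "c \<in> \<A>" "z \<in> slit c"
  shows "(\<Sum>j\<in>UNIV. fst u $ j * \<omega> c z v $ i $ j - fst v $ j * \<omega> c z u $ i $ j) = 0"
proof -
  have "ext_d (\<lambda>w u. fst u $ i) z u v -
      (\<Sum>j\<in>UNIV. wedge (\<lambda>w u. fst u $ j) (\<lambda>w u. \<omega> c w u $ i $ j) z u v) = 0"
    using assms unfolding chern_rund_connection_def Let_def by blast
  then show ?thesis by (simp add: ext_d_def wedge_def)
qed

lemma chern_rund_metric:
  fixes F :: "('a, 'n::finite) finsler_fun"
  assumes "chern_rund_connection \<A> F \<omega>" "c \<in> \<A>" "z \<in> slit c"
  defines "L \<equiv> fin_coord \<A> F c"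
  shows "frechet_derivative (fund L i j) (at z) u
      - (\<Sum>k\<in>UNIV. fund L k j z * \<omega> c z u $ k $ i) - (\<Sum>k\<in>UNIV. fund L i k z * \<omega> c z u $ k $ j)
    = (\<Sum>k\<in>UNIV. 2 * cartan L i j k z * (delta_y L k z u / L z))"
  using assms unfolding chern_rund_connection_def Let_def by blast

lemma chern_rund_linear:
  assumes "chern_rund_connection \<A> F \<omega>" "c \<in> \<A>" "z \<in> slit c"
  shows "linear (\<omega> c z)"
  using assms unfolding chern_rund_connection_def pullback_connection_def by blast

text \<open>Evaluate the torsion condition on a coordinate vector \<open>\<partial>/\<partial>x\<^sup>j\<close> and a vertical vector.\<close>

lemma chern_rund_vertical:
  fixes F :: "('a, 'n::finite) finsler_fun"
  assumes "chern_rund_connection \<A> F \<omega>" "c \<in> \<A>" "z \<in> slit c"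
  shows "\<omega> c z (0, \<eta>) = 0"
proof -
  have "\<omega> c z (0, \<eta>) $ i $ j = 0" for i j
    using chern_rund_torsion[OF assms, of "(axis j 1, 0)" "(0, \<eta>)" i] by (simp add: axis_sum)
  then show ?thesis by (simp add: vec_eq_iff)
qed

text \<open>Evaluate the torsion condition on two coordinate vectors \<open>\<partial>/\<partial>x\<^sup>j\<close> and \<open>\<partial>/\<partial>x\<^sup>k\<close>.\<close>

lemma chern_rund_symmetric:
  fixes F :: "('a, 'n::finite) finsler_fun"
  assumes "chern_rund_connection \<A> F \<omega>" "c \<in> \<A>" "z \<in> slit c"
  shows "\<omega> c z (axis k 1, 0) $ i $ j = \<omega> c z (axis j 1, 0) $ i $ k"
  using chern_rund_torsion[OF assms, of "(axis j 1, 0)" "(axis k 1, 0)" i]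
  by (simp add: axis_sum sum_subtractf)

text \<open>The difference of two solutions satisfies the homogeneous conditions: the derivative of \<open>g\<close> and the
Cartan term do not involve the connection.\<close>

lemma chern_rund_unique:
  fixes F :: "('a, 'n::finite) finsler_fun"
  assumes F: "finsler_space X \<A> F"
    and w: "chern_rund_connection \<A> F \<omega>" "chern_rund_connection \<A> F \<omega>'"
    and A: "c \<in> \<A>" and z: "(x, y) \<in> slit c"
  shows "conn_coeff \<omega> c i j k x y = conn_coeff \<omega>' c i j k x y"
proof -
  let ?L = "fin_coord \<A> F c"
  define \<Delta> where "\<Delta> i j k = conn_coeff \<omega> c i j k x y - conn_coeff \<omega>' c i j k x y" for i j k
  have "\<Delta> i j k = 0"
  proof (rule metric_torsion_free_unique[of "\<lambda>i j. fund ?L i j (x, y)"])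
    show "\<Delta> i j k = \<Delta> i k j" for i j k
      unfolding \<Delta>_def conn_coeff_def
      using chern_rund_symmetric[OF w(1) A z] chern_rund_symmetric[OF w(2) A z] by simp
    show "(\<Sum>k\<in>UNIV. fund ?L k j (x, y) * \<Delta> k i l) + (\<Sum>k\<in>UNIV. fund ?L i k (x, y) * \<Delta> k j l) = 0" for i j l
      using chern_rund_metric[OF w(1) A z, of i j "(axis l 1, 0)"]
        chern_rund_metric[OF w(2) A z, of i j "(axis l 1, 0)"]
      unfolding \<Delta>_def conn_coeff_def by (simp add: right_diff_distrib sum_subtractf)
  qed (rule fund_pos[OF F A z])
  then show ?thesis by (simp add: \<Delta>_def)
qed

lemma fin_coord_pos:
  fixes F :: "('a, 'n::finite) finsler_fun"
  assumes F: "finsler_space X \<A> F" and A: "c \<in> \<A>" and x: "x \<in> chart_img c" and y: "y \<noteq> 0"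
  shows "fin_coord \<A> F c (x, y) > 0"
proof -
  note M = finsler_manifold[OF F]
  let ?L = "fin_coord \<A> F c"
  have z: "(x, y) \<in> slit c" using x y by (simp add: slit_def)
  have "(\<Sum>i\<in>UNIV. \<Sum>j\<in>UNIV. fund ?L i j (x, y) * y $ i * y $ j) = (?L (x, y))\<^sup>2"
    using fund_euler(4)[OF chart_img_open[OF M A] fin_coord_smooth[OF F A, unfolded slit_def]
        fin_coord_homogeneous[OF F A], of "(x, y)"] x y
    by (simp add: mult_ac)
  with fund_pos[OF F A z y] have "?L (x, y) \<noteq> 0" by auto
  moreover have "?L (x, y) \<ge> 0"
  proof -
    have "chart_inv c x \<in> topspace X" using chart_chart_inv(1)[OF x] chart_dom_topspace[OF M A] by blast
    then show ?thesis using F coord_vec_tangent[OF M A x] by (simp add: fin_coord_def finsler_space_def)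
  qed
  ultimately show ?thesis by simp
qed

lemma fin_coord_gauge:
  fixes F :: "('a, 'n::finite) finsler_fun"
  assumes F: "finsler_space X \<A> F" and A: "c \<in> \<A>" and x: "x \<in> chart_img c"
  shows "gauge_like (\<lambda>y. fin_coord \<A> F c (x, y))"
proof (rule gauge_like_continuous)
  show "continuous_on (- {0}) (\<lambda>y. fin_coord \<A> F c (x, y))"
    by (rule continuous_on_compose2[OF smooth_on_imp_continuous_on[OF fin_coord_smooth[OF F A]]])
      (use x in \<open>auto simp: slit_def intro!: continuous_intros\<close>)
qed (use fin_coord_homogeneous[OF F A x] fin_coord_pos[OF F A x] in auto)

text \<open>The corresponding identity for the square of the Finsler function may be divided by \<open>2 F > 0\<close>.\<close>

lemma fin_coord_horizontal:
  fixes F :: "('a, 'n::finite) finsler_fun"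
  assumes F: "finsler_space X \<A> F" and w: "chern_rund_connection \<A> F \<omega>"
    and A: "c \<in> \<A>" and x: "x \<in> chart_img c" and y: "y \<noteq> 0"
  defines "L \<equiv> fin_coord \<A> F c"
  shows "frechet_derivative L (at (x, y)) (\<xi>, 0) =
    frechet_derivative L (at (x, y)) (0, \<omega> c (x, y) (\<xi>, 0) *v y)"
proof -
  note M = finsler_manifold[OF F]
  have z: "(x, y) \<in> slit c" using x y by (simp add: slit_def)
  have sm: "smooth_on (slit c) L" unfolding L_def by (rule fin_coord_smooth[OF F A])
  have "frechet_derivative (\<lambda>w. (L w)\<^sup>2) (at (x, y)) (\<xi>, 0) =
    frechet_derivative (\<lambda>w. (L w)\<^sup>2) (at (x, y)) (0, \<omega> c (x, y) (\<xi>, 0) *v y)"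
    unfolding L_def
    by (rule energy_horizontal_derivative[where om = "\<omega> c (x, y)"
          and T = "\<lambda>k. delta_y (fin_coord \<A> F c) k (x, y) (\<xi>, 0) / fin_coord \<A> F c (x, y)", OF chart_img_open[OF M A] x y
          fin_coord_smooth[OF F A, unfolded slit_def]
          fin_coord_homogeneous[OF F A] chern_rund_metric[OF w A z]])
  moreover have "frechet_derivative (\<lambda>w. (L w)\<^sup>2) (at (x, y)) = (\<lambda>u. 2 * L (x, y) * frechet_derivative L (at (x, y)) u)"
  proof (rule frechet_derivative_at[symmetric])
    show "((\<lambda>w. (L w)\<^sup>2) has_derivative (\<lambda>u. 2 * L (x, y) * frechet_derivative L (at (x, y)) u)) (at (x, y))"
      using smooth_on_has_derivative[OF sm z] by (auto intro!: derivative_eq_intros)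
  qed
  ultimately show ?thesis using fin_coord_pos[OF F A x y] by (simp add: L_def)
qed

section \<open>The descended affine connection\<close>

lemma berwald_coeff:
  fixes F :: "('a, 'n::finite) finsler_fun"
  assumes B: "berwald_space X \<A> F" and w: "chern_rund_connection \<A> F \<omega>"
    and A: "c \<in> \<A>" and x: "x \<in> chart_img c" and y: "y \<noteq> 0" "y' \<noteq> 0"
  shows "conn_coeff \<omega> c i j k x y = conn_coeff \<omega> c i j k x y'"
proof -
  have F: "finsler_space X \<A> F" using B by (simp add: berwald_space_def)
  obtain \<omega>' where w': "chern_rund_connection \<A> F \<omega>'"
    "\<And>c x y y' i j k. c \<in> \<A> \<Longrightarrow> x \<in> chart_img c \<Longrightarrow> y \<noteq> 0 \<Longrightarrow> y' \<noteq> 0 \<Longrightarrow>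
      conn_coeff \<omega>' c i j k x y = conn_coeff \<omega>' c i j k x y'"
    using B unfolding berwald_space_def by blast
  have z: "(x, y) \<in> slit c" "(x, y') \<in> slit c" using x y by (auto simp: slit_def)
  show ?thesis
    unfolding chern_rund_unique[OF F w w'(1) A z(1)] chern_rund_unique[OF F w w'(1) A z(2)]
    by (rule w'(2)[OF A x y])
qed

text \<open>The vertical component \<open>\<eta>\<close> is arbitrary so that the lemma applies to the image of a horizontal coordinate
vector under a change of natural coordinates, which need not be horizontal.\<close>

lemma descended_connection_eq:
  fixes F :: "('a, 'n::finite) finsler_fun"
  assumes B: "berwald_space X \<A> F" and w: "chern_rund_connection \<A> F \<omega>"
    and A: "c \<in> \<A>" and x: "x \<in> chart_img c" and y: "y \<noteq> 0"
  shows "descended_connection \<omega> c x \<xi> = \<omega> c (x, y) (\<xi>, \<eta>)"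
proof -
  have z: "(x, y) \<in> slit c" using x y by (simp add: slit_def)
  have lin: "linear (\<omega> c (x, y))" by (rule chern_rund_linear[OF w A z])
  have THE: "(THE G. \<forall>y. y \<noteq> 0 \<longrightarrow> conn_coeff \<omega> c i j k x y = G) = conn_coeff \<omega> c i j k x y" for i j k
    by (rule the_equality) (use berwald_coeff[OF B w A x] y in blast)+
  have dec: "(\<xi>, \<eta>) = (\<Sum>k\<in>UNIV. \<xi> $ k *\<^sub>R ((axis k 1, 0) :: (real^'n) \<times> (real^'n))) + (0, \<eta>)"
    by (simp add: prod_eq_iff fst_sum snd_sum basis_expansion scalar_mult_eq_scaleR[symmetric])
  have "\<omega> c (x, y) (\<xi>, \<eta>) = (\<Sum>k\<in>UNIV. \<xi> $ k *\<^sub>R \<omega> c (x, y) (axis k 1, 0))"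
    unfolding dec by (simp only: linear_add[OF lin] linear_sum[OF lin] linear_scale[OF lin]
        chern_rund_vertical[OF w A z]) simp
  then have "\<omega> c (x, y) (\<xi>, \<eta>) $ i $ j = (\<Sum>k\<in>UNIV. conn_coeff \<omega> c i j k x y * \<xi> $ k)" for i j
    by (simp add: conn_coeff_def mult.commute)
  then show ?thesis
    unfolding descended_connection_def THE by (simp add: vec_eq_iff)
qed

lemma smooth_on_trans_jac:
  fixes c d :: "('a, 'b::finite) chart"
  assumes M: "smooth_manifold X \<A>" and A: "c \<in> \<A>" "d \<in> \<A>"
  shows "smooth_on (overlap c d) (trans_jac c d)"
proof -
  have T: "smooth_on (overlap c d) (transition c d)" using assms by (simp add: smooth_manifold_def)
  \<comment> \<open>\<open>E j v\<close> is the matrix with \<open>v\<close> in column \<open>j\<close> and zeros elsewhere\<close>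
  define E :: "'b \<Rightarrow> real^'b \<Rightarrow> real^'b^'b" where "E j v = (\<chi> i k. if k = j then v $ i else 0)" for j v
  have bl: "bounded_linear (E j)" for j
    unfolding linear_conv_bounded_linear[symmetric]
    by (rule linearI) (simp_all add: E_def vec_eq_iff)
  have eq: "trans_jac c d = (\<lambda>x. \<Sum>j\<in>UNIV. E j (frechet_derivative (transition c d) (at x) (axis j 1)))"
    unfolding trans_jac_def jacobian_def by (simp add: E_def vec_eq_iff matrix_def fun_eq_iff)
  show ?thesis
    unfolding smooth_on_def eq
  proof
    fix k
    have "Ck_on k (overlap c d) (\<lambda>x. frechet_derivative (transition c d) (at x) v)" for v
      using smooth_on_frechet_derivative[OF T, of v] by (simp add: smooth_on_def)
    then show "Ck_on k (overlap c d) (\<lambda>x. \<Sum>j\<in>UNIV. E j (frechet_derivative (transition c d) (at x) (axis j 1)))"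
      by (intro Ck_on_sum[OF overlap_open[OF M A]] Ck_on_bounded_linear[OF overlap_open[OF M A] bl])
  qed
qed

lemma trans_jac_mult:
  assumes "smooth_manifold X \<A>" "c \<in> \<A>" "d \<in> \<A>" "x \<in> overlap c d"
  shows "trans_jac c d x *v v = frechet_derivative (transition c d) (at x) v"
  unfolding trans_jac_def jacobian_def using fun_cong[OF matrix_vector_mul(2)[OF transition_linear[OF assms]], of v] .

lemma bounded_bilinear_matrix_vector_mult:
  "bounded_bilinear ((*v) :: real^'n::finite^'m::finite \<Rightarrow> real^'n \<Rightarrow> real^'m)"
  unfolding bilinear_conv_bounded_bilinear[symmetric] bilinear_def
proof (intro conjI allI)
  fix y :: "real^'n"
  show "linear (\<lambda>A :: real^'n^'m. A *v y)"
    by (rule linearI) (simp_all add: matrix_vector_mult_def vec_eq_iff sum.distrib distrib_right sum_distrib_left mult.assoc)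
qed (rule matrix_vector_mul_linear)

text \<open>The second component, which contains the second derivatives of the change of coordinates, is left
unspecified: connection forms of Chern-Rund type vanish on vertical vectors.\<close>

lemma nat_transition_derivative:
  fixes c d :: "('a, 'b::finite) chart"
  assumes M: "smooth_manifold X \<A>" and A: "c \<in> \<A>" "d \<in> \<A>" and x: "x \<in> overlap c d"
  obtains \<eta> where "\<And>\<xi>. frechet_derivative (nat_transition c d) (at (x, y)) (\<xi>, 0) =
    (frechet_derivative (transition c d) (at x) \<xi>, \<eta> \<xi>)"
proof -
  let ?T = "transition c d" and ?J = "trans_jac c d"
  have opO: "open (overlap c d \<times> (UNIV :: (real^'b) set))" by (intro open_Times overlap_open[OF M A]) auto
  have J: "(?J has_derivative frechet_derivative ?J (at x)) (at x)"
    by (rule smooth_on_has_derivative[OF smooth_on_trans_jac[OF M A] x])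
  have "((\<lambda>z. (?T (fst z), ?J (fst z) *v snd z)) has_derivative
     (\<lambda>u. (frechet_derivative ?T (at x) (fst u),
        ?J x *v snd u + frechet_derivative ?J (at x) (fst u) *v y))) (at (x, y))"
  proof (intro has_derivative_Pair)
    have f: "(fst has_derivative fst) (at (x, y))" by (intro derivative_intros)
    show "((\<lambda>z. ?T (fst z)) has_derivative (\<lambda>u. frechet_derivative ?T (at x) (fst u))) (at (x, y))"
      using has_derivative_compose[OF f, of ?T] transition_derivative[OF M A x] by simp
    have "((\<lambda>z. ?J (fst z)) has_derivative (\<lambda>u. frechet_derivative ?J (at x) (fst u))) (at (x, y))"
      using has_derivative_compose[OF f, of ?J] J by simp
    from bounded_bilinear.FDERIV[OF bounded_bilinear_matrix_vector_mult this has_derivative_snd[OF has_derivative_ident]]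
    show "((\<lambda>z. ?J (fst z) *v snd z) has_derivative
        (\<lambda>u. ?J x *v snd u + frechet_derivative ?J (at x) (fst u) *v y)) (at (x, y))" by simp
  qed
  then have "(nat_transition c d has_derivative
     (\<lambda>u. (frechet_derivative ?T (at x) (fst u),
        ?J x *v snd u + frechet_derivative ?J (at x) (fst u) *v y))) (at (x, y))"
    by (rule has_derivative_transform_within_open[OF _ opO])
      (use x in \<open>auto simp: nat_transition_def trans_jac_mult[OF M A]\<close>)
  from frechet_derivative_at[OF this, symmetric] show ?thesis
    by (intro that[of "\<lambda>\<xi>. ?J x *v 0 + frechet_derivative ?J (at x) \<xi> *v y"]) simp
qed

text \<open>Everything is inherited from the connection on the pull-back bundle along the section of the slit
bundle that has constant components \<open>y0 \<noteq> 0\<close> in the given chart. A change of charts does not preserve these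
sections, but in the other chart any nonzero fibre component serves equally well.\<close>

lemma descended_affine_connection:
  fixes F :: "('a, 'n::finite) finsler_fun"
  assumes B: "berwald_space X \<A> F" and w: "chern_rund_connection \<A> F \<omega>"
  shows "affine_connection \<A> (descended_connection \<omega>)"
proof -
  have F: "finsler_space X \<A> F" using B by (simp add: berwald_space_def)
  note M = finsler_manifold[OF F]
  define y0 :: "real^'n" where "y0 = axis undefined 1"
  have y0: "y0 \<noteq> 0" by (simp add: y0_def axis_eq_0_iff)
  note D = descended_connection_eq[OF B w _ _ y0]
  show ?thesis
    unfolding affine_connection_def
  proof (intro conjI ballI allI)
    fix c x assume A: "c \<in> \<A>" and x: "x \<in> chart_img c"
    have "linear (\<omega> c (x, y0))" by (rule chern_rund_linear[OF w A]) (use x y0 in \<open>simp add: slit_def\<close>)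
    moreover have "linear (\<lambda>\<xi>. (\<xi>, 0) :: (real^'n) \<times> (real^'n))" by (rule linearI) simp_all
    ultimately have "linear (\<lambda>\<xi>. \<omega> c (x, y0) (\<xi>, 0))"
      using linear_compose unfolding o_def by blast
    moreover have "descended_connection \<omega> c x = (\<lambda>\<xi>. \<omega> c (x, y0) (\<xi>, 0))"
      by (rule ext) (rule D[OF A x])
    ultimately show "linear (descended_connection \<omega> c x)" by simp
  next
    fix c \<xi> assume A: "c \<in> \<A>"
    have sm: "smooth_on (slit c) (\<lambda>z. \<omega> c z (\<xi>, 0))"
      using w A unfolding chern_rund_connection_def pullback_connection_def by blast
    show "smooth_on (chart_img c) (\<lambda>x. descended_connection \<omega> c x \<xi>)"
      unfolding smooth_on_def
    proof
      fix k
      have "Ck_on k (chart_img c) (\<lambda>x. \<omega> c ((0, y0) + (x, 0)) (\<xi>, 0))"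
        by (rule Ck_on_compose_affine[OF chart_img_open[OF M A], where T = "slit c" and f = "\<lambda>z. \<omega> c z (\<xi>, 0)"])
          (use sm y0 in \<open>auto simp: smooth_on_def slit_def intro!: bounded_linear_Pair bounded_linear_ident bounded_linear_zero\<close>)
      then show "Ck_on k (chart_img c) (\<lambda>x. descended_connection \<omega> c x \<xi>)"
        by (rule Ck_on_cong[OF chart_img_open[OF M A], rotated]) (simp add: D[OF A, where \<eta> = 0])
    qed
  next
    fix c d x \<xi> assume A: "c \<in> \<A>" "d \<in> \<A>" and x: "x \<in> overlap c d"
    let ?T = "frechet_derivative (transition c d) (at x)"
    have xi: "x \<in> chart_img c" using x overlap_iff[OF M A(1)] by simp
    have z: "(x, y0) \<in> slit c" using xi y0 by (simp add: slit_def)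
    have xd: "transition c d x \<in> chart_img d"
      using transition_overlap(2)[OF M A x] overlap_iff[OF M A(2)] by simp
    have Ty: "?T y0 \<noteq> 0"
      using transition_inverse[OF M A x, of y0] y0
        linear_0[OF transition_linear[OF M A(2,1) transition_overlap(2)[OF M A x]]] by auto
    obtain \<eta> where \<eta>: "\<And>\<xi>. frechet_derivative (nat_transition c d) (at (x, y0)) (\<xi>, 0) = (?T \<xi>, \<eta> \<xi>)"
      using nat_transition_derivative[OF M A x] by blast
    have "(fst has_derivative fst) (at (x, y0))" by (intro derivative_intros)
    from has_derivative_compose[OF this, of "trans_jac c d"]
      smooth_on_has_derivative[OF smooth_on_trans_jac[OF M A] x]
    have "((\<lambda>w. trans_jac c d (fst w)) has_derivative (\<lambda>u. frechet_derivative (trans_jac c d) (at x) (fst u))) (at (x, y0))"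
      by simp
    note J = frechet_derivative_at[OF this, symmetric]
    have "trans_jac c d (fst (x, y0)) ** \<omega> c (x, y0) (\<xi>, 0) =
        frechet_derivative (\<lambda>w. trans_jac c d (fst w)) (at (x, y0)) (\<xi>, 0) +
        \<omega> d (nat_transition c d (x, y0)) (frechet_derivative (nat_transition c d) (at (x, y0)) (\<xi>, 0))
          ** trans_jac c d (fst (x, y0))"
      using w A x z unfolding chern_rund_connection_def pullback_connection_def by fastforce
    then show "trans_jac c d x ** descended_connection \<omega> c x \<xi> =
        frechet_derivative (trans_jac c d) (at x) \<xi> +
        descended_connection \<omega> d (transition c d x) (?T \<xi>) ** trans_jac c d x"
      unfolding \<eta> J
      by (simp add: nat_transition_def D[OF A(1) xi, of \<xi> 0]
          descended_connection_eq[OF B w A(2) xd Ty, of "?T \<xi>" "\<eta> \<xi>"])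
  qed
qed

section \<open>The averaged metric\<close>

text \<open>The value does not depend on the chosen chart, by \<open>averaged_metric_chart\<close>.\<close>

definition averaged_metric :: "('a, 'n::finite) chart set \<Rightarrow> ('a, 'n) finsler_fun \<Rightarrow> ('a, 'n) metric_field" where
  "averaged_metric \<A> F p u v = (let c = SOME c. c \<in> \<A> \<and> p \<in> chart_dom c in
     body_form (\<lambda>y. fin_coord \<A> F c (snd c p, y)) (u c) (v c))"

text \<open>Two coordinate expressions of the Finsler function at \<open>p\<close> differ by a linear bijection, the differential
of the change of coordinates, and so do the components of \<open>u\<close> and \<open>v\<close>; this is the situation of
\<open>body_form_compose\<close>.\<close>

lemma averaged_metric_chart:
  fixes F :: "('a, 'n::finite) finsler_fun"
  assumes F: "finsler_space X \<A> F" and A: "c \<in> \<A>" and p: "p \<in> chart_dom c"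
    and u: "u \<in> tangent_space \<A> p" and v: "v \<in> tangent_space \<A> p"
  shows "averaged_metric \<A> F p u v = body_form (\<lambda>y. fin_coord \<A> F c (snd c p, y)) (u c) (v c)"
proof -
  note M = finsler_manifold[OF F]
  define d where "d = (SOME d. d \<in> \<A> \<and> p \<in> chart_dom d)"
  have "d \<in> \<A> \<and> p \<in> chart_dom d" unfolding d_def by (rule someI[of _ c]) (use A p in simp)
  then have d: "d \<in> \<A>" "p \<in> chart_dom d" by auto
  define x where "x = snd c p"
  have x: "x \<in> overlap c d" using p d by (auto simp: x_def overlap_def)
  have x': "transition c d x = snd d p"
    using transition_overlap(3)[OF M A d(1) x] chart_inv_chart[OF M A p] by (simp add: x_def)
  have xd: "snd d p \<in> chart_img d" using d by (simp add: chart_img_def)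
  let ?T = "frechet_derivative (transition c d) (at x)"
  let ?T' = "frechet_derivative (transition d c) (at (snd d p))"
  have od: "snd d p \<in> overlap d c" using p d by (auto simp: overlap_def)
  have x'': "transition d c (snd d p) = x" using transition_inverse_point[OF M A d(1) x] x' by simp
  have uv: "u d = ?T (u c)" "v d = ?T (v c)"
    using u v A d p unfolding tangent_space_def x_def by blast+
  have "body_form (\<lambda>y. fin_coord \<A> F c (x, y)) (u c) (v c) =
    body_form (\<lambda>y. fin_coord \<A> F d (snd d p, ?T y)) (u c) (v c)"
    using fin_coord_change_chart[OF F A d(1) x] by (simp add: x')
  also have "\<dots> = body_form (\<lambda>y. fin_coord \<A> F d (snd d p, y)) (?T (u c)) (?T (v c))"
  proof (rule body_form_compose)
    show "linear ?T" by (rule transition_linear[OF M A d(1) x])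
    show "linear ?T'" by (rule transition_linear[OF M d(1) A od])
    show "?T' (?T v) = v" for v using transition_inverse[OF M A d(1) x, of v] by (simp add: x')
    show "?T (?T' v) = v" for v using transition_inverse[OF M d(1) A od, of v] by (simp add: x'')
    show "gauge_like (\<lambda>y. fin_coord \<A> F d (snd d p, y))" by (rule fin_coord_gauge[OF F d(1) xd])
  qed
  finally show ?thesis unfolding averaged_metric_def Let_def d_def[symmetric] by (simp add: uv x_def)
qed

lemma metric_coord_averaged:
  fixes F :: "('a, 'n::finite) finsler_fun"
  assumes F: "finsler_space X \<A> F" and A: "c \<in> \<A>" and x: "x \<in> chart_img c"
  shows "metric_coord \<A> (averaged_metric \<A> F) c i j x =
    body_form (\<lambda>y. fin_coord \<A> F c (x, y)) (axis i 1) (axis j 1)"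
proof -
  note M = finsler_manifold[OF F]
  show ?thesis
    unfolding metric_coord_def
    using averaged_metric_chart[OF F A chart_chart_inv(1)[OF x]
        coord_vec_tangent[OF M A x, of "axis i 1"] coord_vec_tangent[OF M A x, of "axis j 1"]]
    by (simp add: chart_chart_inv(2)[OF x] coord_vec_chart[OF M A x])
qed

text \<open>Polarization of \<open>body_form_has_derivative\<close> for the linear maps \<open>G \<xi> = \<Gamma>\<^sub>\<xi>\<close>. The formula says that the averaged
metric is parallel.\<close>

lemma averaged_metric_derivative:
  fixes F :: "('a, 'n::finite) finsler_fun"
  assumes B: "berwald_space X \<A> F" and w: "chern_rund_connection \<A> F \<omega>"
    and A: "c \<in> \<A>" and x: "x \<in> chart_img c"
  defines "H \<equiv> metric_coord \<A> (averaged_metric \<A> F) c"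
  shows "(H i j has_derivative
     (\<lambda>\<xi>. (\<Sum>k\<in>UNIV. H k j x * descended_connection \<omega> c x \<xi> $ k $ i) +
          (\<Sum>k\<in>UNIV. H i k x * descended_connection \<omega> c x \<xi> $ k $ j))) (at x)"
proof -
  have F: "finsler_space X \<A> F" using B by (simp add: berwald_space_def)
  note M = finsler_manifold[OF F]
  let ?L = "fin_coord \<A> F c"
  define D where "D = descended_connection \<omega> c x"
  define G where "G \<xi> y = D \<xi> *v y" for \<xi> y
  have linD: "linear D" using descended_affine_connection[OF B w] A x unfolding affine_connection_def D_def by blast
  have bb: "bounded_bilinear G"
    unfolding G_def
    by (rule bounded_bilinear.comp1[OF bounded_bilinear_matrix_vector_mult])
      (use linD in \<open>simp add: linear_conv_bounded_linear\<close>)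
  define M0 where "M0 = body_form (\<lambda>y. ?L (x, y))"
  note g0 = fin_coord_gauge[OF F A]
  have der: "((\<lambda>x. body_form (\<lambda>y. ?L (x, y)) u u) has_derivative (\<lambda>\<xi>. 2 * M0 u (G \<xi> u))) (at x)" for u
    unfolding M0_def
  proof (rule body_form_has_derivative[OF chart_img_open[OF M A] x])
    show "?L differentiable (at (x, y))" if "x \<in> chart_img c" "y \<noteq> 0" for x y
      using smooth_on_has_derivative[OF fin_coord_smooth[OF F A], of "(x, y)"] that
      by (auto simp: slit_def differentiable_def)
    show "continuous_on (chart_img c \<times> (UNIV - {0})) (\<lambda>z. frechet_derivative ?L (at z) v)" for v
      using smooth_on_imp_continuous_on[OF smooth_on_frechet_derivative[OF fin_coord_smooth[OF F A]]]
      by (simp add: slit_def)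
    show "frechet_derivative ?L (at (x, y)) (\<xi>, 0) = frechet_derivative ?L (at (x, y)) (0, G \<xi> y)"
      if "y \<noteq> 0" for \<xi> y
      using fin_coord_horizontal[OF F w A x that, of \<xi>] descended_connection_eq[OF B w A x that, of \<xi> 0]
      by (simp add: G_def D_def)
  qed (use fin_coord_homogeneous[OF F A] g0 bb in auto)
  let ?u = "axis i 1 :: real^'n" and ?v = "axis j 1 :: real^'n"
  have add: "M0 (p + q) w = M0 p w + M0 q w" for p q w
    using body_form_linear[OF g0[OF x], of 1 p 1 q w] by (simp add: M0_def)
  have sym: "M0 p q = M0 q p" for p q unfolding M0_def by (rule body_form_sym)
  have lin: "linear (\<lambda>p. M0 p q)" for q
    using body_form_linear[OF g0[OF x], of _ _ 0 0] add by (intro linearI) (auto simp: M0_def)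
  have expand: "M0 (D \<xi> *v axis l 1) (axis m 1) = (\<Sum>k\<in>UNIV. H k m x * D \<xi> $ k $ l)" for \<xi> l m
  proof -
    have "D \<xi> *v axis l 1 = (\<Sum>k\<in>UNIV. (D \<xi> $ k $ l) *\<^sub>R axis k 1)"
      unfolding matrix_vector_mult_basis by (simp add: vec_eq_iff column_def axis_def if_distrib[of "\<lambda>x. _ * x"] cong: if_cong)
    then show ?thesis
      by (simp only: linear_sum[OF lin] linear_scale[OF lin])
        (simp add: H_def metric_coord_averaged[OF F A x] M0_def mult.commute)
  qed
  have "((\<lambda>x. (body_form (\<lambda>y. ?L (x, y)) (?u + ?v) (?u + ?v) - body_form (\<lambda>y. ?L (x, y)) ?u ?u
       - body_form (\<lambda>y. ?L (x, y)) ?v ?v) / 2) has_derivative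
     (\<lambda>\<xi>. (2 * M0 (?u + ?v) (G \<xi> (?u + ?v)) - 2 * M0 ?u (G \<xi> ?u) - 2 * M0 ?v (G \<xi> ?v)) / 2)) (at x)"
    by (rule bounded_linear.has_derivative[OF bounded_linear_divide]) (intro has_derivative_diff der)
  then have "(H i j has_derivative
     (\<lambda>\<xi>. (2 * M0 (?u + ?v) (G \<xi> (?u + ?v)) - 2 * M0 ?u (G \<xi> ?u) - 2 * M0 ?v (G \<xi> ?v)) / 2)) (at x)"
    by (rule has_derivative_transform_within_open[OF _ chart_img_open[OF M A] x])
      (simp add: H_def metric_coord_averaged[OF F A] body_form_polarization[OF g0, symmetric])
  moreover have "(2 * M0 (?u + ?v) (G \<xi> (?u + ?v)) - 2 * M0 ?u (G \<xi> ?u) - 2 * M0 ?v (G \<xi> ?v)) / 2 =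
     (\<Sum>k\<in>UNIV. H k j x * D \<xi> $ k $ i) + (\<Sum>k\<in>UNIV. H i k x * D \<xi> $ k $ j)" for \<xi>
  proof -
    have "H i k x = H k i x" for k
      by (simp add: H_def metric_coord_averaged[OF F A x] body_form_sym)
    then have "(\<Sum>k\<in>UNIV. H k j x * D \<xi> $ k $ i) + (\<Sum>k\<in>UNIV. H i k x * D \<xi> $ k $ j) =
      M0 (G \<xi> ?u) ?v + M0 (G \<xi> ?v) ?u"
      by (simp add: expand G_def)
    moreover have "M0 (?u + ?v) (G \<xi> (?u + ?v)) = M0 (G \<xi> ?u) ?u + M0 (G \<xi> ?v) ?u + M0 (G \<xi> ?u) ?v + M0 (G \<xi> ?v) ?v"
      unfolding bounded_bilinear.add_right[OF bb] add sym[of ?u] sym[of ?v] by simp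
    ultimately show ?thesis by (simp add: sym[of ?u] sym[of ?v])
  qed
  ultimately show ?thesis by (simp add: D_def)
qed

text \<open>The system of \<open>averaged_metric_derivative\<close> is linear in the metric with the smooth coefficients of the
descended connection, so regularity can be bootstrapped.\<close>

lemma averaged_metric_smooth:
  fixes F :: "('a, 'n::finite) finsler_fun"
  assumes B: "berwald_space X \<A> F" and w: "chern_rund_connection \<A> F \<omega>" and A: "c \<in> \<A>"
  shows "smooth_on (chart_img c) (metric_coord \<A> (averaged_metric \<A> F) c i j)"
proof -
  have F: "finsler_space X \<A> F" using B by (simp add: berwald_space_def)
  note M = finsler_manifold[OF F]
  let ?S = "chart_img c"
  note op = chart_img_open[OF M A]
  let ?H = "metric_coord \<A> (averaged_metric \<A> F) c"
  define m where "m = (\<lambda>(i, j). ?H i j)"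
  define D where "D = (\<lambda>(i, j) \<xi> x. (\<Sum>k\<in>UNIV. ?H k j x * descended_connection \<omega> c x \<xi> $ k $ i) +
          (\<Sum>k\<in>UNIV. ?H i k x * descended_connection \<omega> c x \<xi> $ k $ j))"
  have "smooth_on ?S (m (i, j))"
  proof (rule smooth_on_bootstrap[OF op, of m D])
    show "(m p has_derivative (\<lambda>v. D p v x)) (at x)" if "x \<in> ?S" for p x
      using averaged_metric_derivative[OF B w A that] by (cases p) (simp add: m_def D_def)
    show "Ck_on n ?S (D p \<xi>)" if hyp: "\<And>p. Ck_on n ?S (m p)" for n p \<xi>
    proof -
      have H: "Ck_on n ?S (?H a b)" for a b using hyp[of "(a, b)"] by (simp add: m_def)
      have C: "Ck_on n ?S (\<lambda>x. descended_connection \<omega> c x \<xi> $ a $ b)" for a b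
      proof (rule Ck_on_bounded_linear[OF op, of "\<lambda>m. m $ a $ b"])
        show "bounded_linear (\<lambda>m::real^'n^'n. m $ a $ b)"
          by (intro bounded_linear_compose[OF bounded_linear_vec_nth bounded_linear_vec_nth])
        show "Ck_on n ?S (\<lambda>x. descended_connection \<omega> c x \<xi>)"
          using descended_affine_connection[OF B w] A unfolding affine_connection_def smooth_on_def by blast
      qed
      show ?thesis
        by (cases p) (auto simp: D_def intro!: Ck_on_add Ck_on_sum Ck_on_mult op H C)
    qed
  qed
  then show ?thesis by (simp add: m_def)
qed

lemma averaged_metric_riemannian:
  fixes F :: "('a, 'n::finite) finsler_fun"
  assumes B: "berwald_space X \<A> F" and w: "chern_rund_connection \<A> F \<omega>"
  shows "riemannian_metric X \<A> (averaged_metric \<A> F)"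
proof -
  have F: "finsler_space X \<A> F" using B by (simp add: berwald_space_def)
  note M = finsler_manifold[OF F]
  have ex: "\<exists>c\<in>\<A>. p \<in> chart_dom c" if "p \<in> topspace X" for p
    using M that unfolding smooth_manifold_def by blast
  have chart: "\<exists>c\<in>\<A>. p \<in> chart_dom c \<and> gauge_like (\<lambda>y. fin_coord \<A> F c (snd c p, y)) \<and>
     averaged_metric \<A> F p = (\<lambda>u v. body_form (\<lambda>y. fin_coord \<A> F c (snd c p, y)) (u c) (v c))"
    if p: "p \<in> topspace X" for p
  proof -
    define c where "c = (SOME c. c \<in> \<A> \<and> p \<in> chart_dom c)"
    have "c \<in> \<A> \<and> p \<in> chart_dom c" unfolding c_def by (rule someI_ex) (use ex[OF p] in blast)
    moreover from this have "gauge_like (\<lambda>y. fin_coord \<A> F c (snd c p, y))"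
      by (intro fin_coord_gauge[OF F]) (auto simp: chart_img_def)
    ultimately show ?thesis
      by (intro bexI[of _ c]) (auto simp: fun_eq_iff averaged_metric_def Let_def c_def[symmetric])
  qed
  show ?thesis
    unfolding riemannian_metric_def
  proof (intro conjI ballI allI impI)
    fix p u v w a b assume p: "p \<in> topspace X"
    obtain c where c: "gauge_like (\<lambda>y. fin_coord \<A> F c (snd c p, y))"
      "averaged_metric \<A> F p = (\<lambda>u v. body_form (\<lambda>y. fin_coord \<A> F c (snd c p, y)) (u c) (v c))"
      using chart[OF p] by blast
    show "averaged_metric \<A> F p (\<lambda>c. a *\<^sub>R u c + b *\<^sub>R v c) w =
        a * averaged_metric \<A> F p u w + b * averaged_metric \<A> F p v w"
      unfolding c(2) by (rule body_form_linear[OF c(1)])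
    show "averaged_metric \<A> F p u v = averaged_metric \<A> F p v u"
      unfolding c(2) by (rule body_form_sym)
  next
    fix p u assume p: "p \<in> topspace X" and u: "u \<in> tangent_space \<A> p" "u \<noteq> (\<lambda>c. 0)"
    obtain c where c: "c \<in> \<A>" "p \<in> chart_dom c" "gauge_like (\<lambda>y. fin_coord \<A> F c (snd c p, y))"
      "averaged_metric \<A> F p = (\<lambda>u v. body_form (\<lambda>y. fin_coord \<A> F c (snd c p, y)) (u c) (v c))"
      using chart[OF p] by blast
    have "u c \<noteq> 0"
    proof
      assume 0: "u c = 0"
      have xi: "snd c p \<in> chart_img c" using c by (simp add: chart_img_def)
      have "u d = 0" for d
        using coord_vec_of_tangent[OF M c(1,2) u(1)] coord_vec_scale[OF M c(1) xi, of 0 0] 0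
        by (metis scaleR_zero_left)
      then show False using u(2) by auto
    qed
    then show "averaged_metric \<A> F p u u > 0" unfolding c(4) by (rule body_form_pos[OF c(3)])
  next
    fix c i j assume "c \<in> \<A>"
    then show "smooth_on (chart_img c) (metric_coord \<A> (averaged_metric \<A> F) c i j)"
      by (rule averaged_metric_smooth[OF B w])
  qed
qed

text \<open>The torsion condition is the one of the Chern-Rund connection on vectors \<open>(\<xi>, 0)\<close>, \<open>(\<eta>, 0)\<close>.\<close>

lemma averaged_metric_levi_civita:
  fixes F :: "('a, 'n::finite) finsler_fun"
  assumes B: "berwald_space X \<A> F" and w: "chern_rund_connection \<A> F \<omega>"
  shows "levi_civita_connection \<A> (averaged_metric \<A> F) (descended_connection \<omega>)"
  unfolding levi_civita_connection_def Let_def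
proof (intro conjI ballI allI)
  show "affine_connection \<A> (descended_connection \<omega>)" by (rule descended_affine_connection[OF B w])
next
  fix c x i \<xi> \<eta> assume A: "c \<in> \<A>" and x: "x \<in> chart_img c"
  define y0 :: "real^'n" where "y0 = axis undefined 1"
  have y0: "y0 \<noteq> 0" by (simp add: y0_def axis_eq_0_iff)
  have z: "(x, y0) \<in> slit c" using x y0 by (simp add: slit_def)
  show "ext_d (\<lambda>w \<xi>. \<xi> $ i) x \<xi> \<eta> -
      (\<Sum>j\<in>UNIV. wedge (\<lambda>w \<xi>. \<xi> $ j) (\<lambda>w \<xi>. descended_connection \<omega> c w \<xi> $ i $ j) x \<xi> \<eta>) = 0"
    using chern_rund_torsion[OF w A z, of "(\<xi>, 0)" "(\<eta>, 0)" i]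
    by (simp add: ext_d_def wedge_def descended_connection_eq[OF B w A x y0, of _ 0])
next
  fix c x i j \<xi> assume A: "c \<in> \<A>" and x: "x \<in> chart_img c"
  let ?H = "metric_coord \<A> (averaged_metric \<A> F) c"
  show "frechet_derivative (?H i j) (at x) \<xi>
      - (\<Sum>k\<in>UNIV. ?H k j x * descended_connection \<omega> c x \<xi> $ k $ i)
      - (\<Sum>k\<in>UNIV. ?H i k x * descended_connection \<omega> c x \<xi> $ k $ j) = 0"
    using frechet_derivative_at[OF averaged_metric_derivative[OF B w A x, of i j], symmetric] by simp
qed

theorem theorem5p2:
  fixes X :: "'a topology"
    and \<A> :: "('a, 'n::finite) chart set"
    and F :: "('a, 'n) finsler_fun"
    and \<omega> :: "('a, 'n) pb_conn"
  assumes "berwald_space X \<A> F"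
    and "chern_rund_connection \<A> F \<omega>"
  shows "\<exists>h D. riemannian_metric X \<A> h \<and> levi_civita_connection \<A> h D \<and>
    (\<forall>p\<in>topspace X. holonomy_group X \<A> (descended_connection \<omega>) p = holonomy_group X \<A> D p)"
  using averaged_metric_riemannian[OF assms] averaged_metric_levi_civita[OF assms] by blast

end
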